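(* Let $h\in\mathcal Z_+'$, and let $s\in\mathcal Z'$ be the corresponding sign-function. Define the distribution $h^\natural(\lambda)=\lambda^{-1}s(-\ln\lambda)$ on $\mathbb R_+$. Then $h^\natural$ belongs to $\mathcal Z_+'$, and $h$ can be recovered from $h^\natural$ by the formula $h=\mathsf L_1^*h^\natural$, that is, $$\langle h,F\rangle=\langle h^\natural,\mathsf L_1F\rangle\qquad\text{for all }F\in\mathcal Z_+,$$ where $(\mathsf L_1F)(\lambda)=\lambda\int_0^\infty e^{-t\lambda}F(t)\,dt$, $\lambda>0$. (Formally, $h(t)=\int_0^\infty e^{-t\lambda}h^\natural(\lambda)\lambda\,d\lambda$.)
   Context: Notation: $\mathbb R_+=(0,\infty)$; $\Gamma$ is the gamma function; $(\Phi u)(\xi)=(2\pi)^{-1/2}\int_{-\infty}^\infty u(x)e^{-ix\xi}dx$ is the Fourier transform. For a topological vector space $\mathcal L$, $\mathcal L'$ is the space of continuous antilinear functionals; brackets $\langle\cdot,\cdot\rangle$ are linear in the first and antilinear in the second argument. $\mathcal Z$ is the set of Schwartz functions $\varphi$ on $\mathbb R$ that extend to entire functions with $|\varphi(z)|\le C_n(1+|z|)^{-n}e^{r|\operatorname{Im}z|}$ for all $n$ and some $r=r(\varphi)>0$; thus $\Phi:C_0^\infty(\mathbb R)\to\mathcal Z$ and $\Phi^*:\mathcal Z\to C_0^\infty(\mathbb R)$ are bijections, and $\mathcal Z$ carries the corresponding topology. $\mathcal Z_+$ is the set of functions $F$ on $\mathbb R_+$ such that $\Omega(x)=F(e^x)$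 belongs to $\mathcal Z$ (with the transferred topology), and $\mathcal Z_+'$ is its dual. For $h\in\mathcal Z_+'$ the distribution $\theta(x)=e^xh(e^x)\in\mathcal Z'$ is defined by $\langle\theta,\Omega\rangle=\langle h,F\rangle$ for $\Omega(x)=F(e^x)$. The sign-function of $h\in\mathcal Z_+'$: put $a=\Phi\theta\in C_0^\infty(\mathbb R)'$, i.e. $\langle a,g\rangle=\langle\theta,\Phi^*g\rangle$; $b(\xi)=(2\pi)^{-1/2}a(\xi)\Gamma(1-i\xi)^{-1}\in C_0^\infty(\mathbb R)'$, i.e. $\langle b,G\rangle=(2\pi)^{-1/2}\langle a,\Gamma(1+i\,\cdot)^{-1}G\rangle$; and $s=\sqrt{2\pi}\,\Phi^*b\in\mathcal Z'$, i.e. $\langle s,\varphi\rangle=\sqrt{2\pi}\langle b,\Phi\varphi\rangle$. The formula $h^\natural(\lambda)=\lambda^{-1}s(-\ln\lambda)$ means $\langle h^\natural,F\rangle=\langle s,\varphi\rangle$ with $\varphi(x)=F(e^{-x})$. The operator $\mathsf L_1$ is a continuous bijection of $\mathcal Z_+$ onto itself. *)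

theory Defs
  imports "HOL-Analysis.Analysis"
begin

section \<open>Test functions and their inductive limit topology\<close>

definition vderiv :: "(real \<Rightarrow> complex) \<Rightarrow> real \<Rightarrow> complex" where
  "vderiv u = (\<lambda>x. vector_derivative u (at x))"

definition smooth :: "(real \<Rightarrow> complex) \<Rightarrow> bool" where
  "smooth u \<longleftrightarrow> (\<forall>n x. (vderiv ^^ n) u differentiable (at x))"

definition test_functions :: "(real \<Rightarrow> complex) set" where
  "test_functions = {u. smooth u \<and> compact (closure {x. u x \<noteq> 0})}"

text \<open>A base of neighbourhoods of zero in the Frechet space of smooth functions supported
  in a compact set \<open>K\<close>.\<close>
definition test_ball :: "real set \<Rightarrow> nat \<Rightarrow> real \<Rightarrow> (real \<Rightarrow> complex) set" where
  "test_ball K N e = {u. smooth u \<and> (\<forall>x. x \<notin> K \<longrightarrow> u x = 0) \<and>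
     (\<forall>k\<le>N. \<forall>x. norm ((vderiv ^^ k) u x) < e)}"

definition absolutely_convex :: "(real \<Rightarrow> complex) set \<Rightarrow> bool" where
  "absolutely_convex V \<longleftrightarrow> (\<forall>u\<in>V. \<forall>v\<in>V. \<forall>a b. norm a + norm b \<le> 1 \<longrightarrow>
     (\<lambda>x. a * u x + b * v x) \<in> V)"

text \<open>The basic neighbourhoods of zero of the finest locally convex topology for which all
  the inclusions of these Frechet spaces are continuous.\<close>
definition test_nhd0 :: "(real \<Rightarrow> complex) set \<Rightarrow> bool" where
  "test_nhd0 V \<longleftrightarrow> V \<subseteq> test_functions \<and> absolutely_convex V \<and>
     (\<forall>K. compact K \<longrightarrow> (\<exists>N. \<exists>e>0. test_ball K N e \<subseteq> V))"

definition test_open :: "(real \<Rightarrow> complex) set \<Rightarrow> bool" where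
  "test_open U \<longleftrightarrow> U \<subseteq> test_functions \<and>
     (\<forall>u\<in>U. \<exists>V. test_nhd0 V \<and> (\<forall>v\<in>V. (\<lambda>x. u x + v x) \<in> U))"

definition test_topology :: "(real \<Rightarrow> complex) topology" where
  "test_topology = topology test_open"

lemma test_nhd0_Int:
  assumes "test_nhd0 V" "test_nhd0 W"
  shows "test_nhd0 (V \<inter> W)"
  unfolding test_nhd0_def
proof (intro conjI allI impI)
  show "V \<inter> W \<subseteq> test_functions"
    using assms by (auto simp: test_nhd0_def)
  show "absolutely_convex (V \<inter> W)"
    using assms by (auto simp: test_nhd0_def absolutely_convex_def)
  fix K :: "real set"
  assume "compact K"
  then obtain N e M d where "e > 0" "test_ball K N e \<subseteq> V" "d > 0" "test_ball K M d \<subseteq> W"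
    using assms unfolding test_nhd0_def by meson
  moreover have "test_ball K (max N M) (min e d) \<subseteq> test_ball K N e \<inter> test_ball K M d"
    by (auto simp: test_ball_def)
  ultimately show "\<exists>N. \<exists>e>0. test_ball K N e \<subseteq> V \<inter> W"
    by (intro exI[of _ "max N M"] exI[of _ "min e d"]) auto
qed

lemma istopology_test_open: "istopology test_open"
  unfolding istopology_def
proof (intro conjI allI impI)
  fix S T
  assume S: "test_open S" and T: "test_open T"
  show "test_open (S \<inter> T)"
    unfolding test_open_def
  proof (intro conjI ballI)
    show "S \<inter> T \<subseteq> test_functions"
      using S by (auto simp: test_open_def)
    fix u
    assume "u \<in> S \<inter> T"
    then have "u \<in> S" "u \<in> T"
      by auto
    from S \<open>u \<in> S\<close> obtain V where "test_nhd0 V" "\<forall>v\<in>V. (\<lambda>x. u x + v x) \<in> S"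
      unfolding test_open_def by auto
    moreover from T \<open>u \<in> T\<close> obtain W where "test_nhd0 W" "\<forall>v\<in>W. (\<lambda>x. u x + v x) \<in> T"
      unfolding test_open_def by auto
    ultimately show "\<exists>V. test_nhd0 V \<and> (\<forall>v\<in>V. (\<lambda>x. u x + v x) \<in> S \<inter> T)"
      by (intro exI[of _ "V \<inter> W"]) (auto intro: test_nhd0_Int)
  qed
next
  fix \<U>
  assume "\<forall>U\<in>\<U>. test_open U"
  then have U: "\<And>U. U \<in> \<U> \<Longrightarrow> test_open U"
    by auto
  show "test_open (\<Union>\<U>)"
    unfolding test_open_def
  proof (intro conjI ballI)
    show "\<Union>\<U> \<subseteq> test_functions"
      using U by (auto simp: test_open_def)
    fix u
    assume "u \<in> \<Union>\<U>"
    then obtain U where "U \<in> \<U>" "u \<in> U"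
      by auto
    with U obtain V where "test_nhd0 V" "\<forall>v\<in>V. (\<lambda>x. u x + v x) \<in> U"
      unfolding test_open_def by meson
    with \<open>U \<in> \<U>\<close> show "\<exists>V. test_nhd0 V \<and> (\<forall>v\<in>V. (\<lambda>x. u x + v x) \<in> \<Union>\<U>)"
      by (intro exI[of _ V]) auto
  qed
qed

lemma openin_test_topology: "openin test_topology = test_open"
  unfolding test_topology_def by (rule topology_inverse'[OF istopology_test_open])

lemma vderiv_funpow_lincomb:
  assumes "smooth u" "smooth v"
  shows "(vderiv ^^ n) (\<lambda>x. a * u x + b * v x) =
    (\<lambda>x. a * (vderiv ^^ n) u x + b * (vderiv ^^ n) v x)"
proof (induction n)
  case (Suc n)
  have "((\<lambda>x. a * (vderiv ^^ n) u x + b * (vderiv ^^ n) v x) has_vector_derivative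
      a * (vderiv ^^ Suc n) u x + b * (vderiv ^^ Suc n) v x) (at x)" for x
  proof -
    have "((vderiv ^^ n) w has_vector_derivative (vderiv ^^ Suc n) w x) (at x)"
      if "smooth w" for w
      using that by (simp add: smooth_def vderiv_def vector_derivative_works)
    then show ?thesis
      using assms by (intro has_vector_derivative_add has_vector_derivative_mult_right) auto
  qed
  then have "vderiv (\<lambda>x. a * (vderiv ^^ n) u x + b * (vderiv ^^ n) v x) =
      (\<lambda>x. a * (vderiv ^^ Suc n) u x + b * (vderiv ^^ Suc n) v x)"
    unfolding vderiv_def by (auto intro!: vector_derivative_at)
  then show ?case
    using Suc.IH by simp
qed simp

lemma smooth_lincomb:
  assumes "smooth u" "smooth v"
  shows "smooth (\<lambda>x. a * u x + b * v x)"
  unfolding smooth_def vderiv_funpow_lincomb[OF assms]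
  using assms by (intro allI differentiable_add differentiable_mult differentiable_const)
    (simp_all add: smooth_def)

lemma test_functions_lincomb:
  assumes "u \<in> test_functions" "v \<in> test_functions"
  shows "(\<lambda>x. a * u x + b * v x) \<in> test_functions"
proof -
  have "{x. a * u x + b * v x \<noteq> 0} \<subseteq> {x. u x \<noteq> 0} \<union> {x. v x \<noteq> 0}"
    by auto
  moreover have "bounded ({x. u x \<noteq> 0} \<union> {x. v x \<noteq> 0})"
    using assms by (simp add: test_functions_def compact_closure)
  ultimately have "bounded {x. a * u x + b * v x \<noteq> 0}"
    by (rule bounded_subset[rotated])
  then have "compact (closure {x. a * u x + b * v x \<noteq> 0})"
    by (simp add: compact_closure)
  moreover have "smooth (\<lambda>x. a * u x + b * v x)"
    using assms by (simp add: test_functions_def smooth_lincomb)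
  ultimately show ?thesis
    by (simp add: test_functions_def)
qed

lemma test_ball_subset:
  assumes "compact K"
  shows "test_ball K N e \<subseteq> test_functions"
proof
  fix u
  assume u: "u \<in> test_ball K N e"
  then have "{x. u x \<noteq> 0} \<subseteq> K"
    by (auto simp: test_ball_def)
  then have "bounded {x. u x \<noteq> 0}"
    using assms bounded_subset compact_imp_bounded by blast
  then have "compact (closure {x. u x \<noteq> 0})"
    by (simp add: compact_closure)
  then show "u \<in> test_functions"
    using u by (simp add: test_functions_def test_ball_def)
qed

lemma test_nhd0_test_functions: "test_nhd0 test_functions"
  unfolding test_nhd0_def absolutely_convex_def
  by (intro conjI order_refl ballI allI impI test_functions_lincomb)
    (auto intro: zero_less_one dest: test_ball_subset)

lemma topspace_test_topology: "topspace test_topology = test_functions"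
proof -
  have "(\<lambda>x. u x + v x) \<in> test_functions"
    if "u \<in> test_functions" "v \<in> test_functions" for u v
    using test_functions_lincomb[OF that, of 1 1] by simp
  then have "test_open test_functions"
    unfolding test_open_def using test_nhd0_test_functions by auto
  then show ?thesis
    unfolding topspace_def openin_test_topology by (intro equalityI) (auto simp: test_open_def)
qed


section \<open>The Fourier transform and the spaces of entire functions\<close>

definition fourier :: "(real \<Rightarrow> complex) \<Rightarrow> real \<Rightarrow> complex" where
  "fourier u = (\<lambda>\<xi>. of_real ((2 * pi) powr (-1/2)) *
     (LINT x|lborel. u x * exp (- \<i> * of_real x * of_real \<xi>)))"

definition fourier_adj :: "(real \<Rightarrow> complex) \<Rightarrow> real \<Rightarrow> complex" where
  "fourier_adj g = (\<lambda>x. of_real ((2 * pi) powr (-1/2)) *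
     (LINT \<xi>|lborel. g \<xi> * exp (\<i> * of_real x * of_real \<xi>)))"

definition schwartz :: "(real \<Rightarrow> complex) set" where
  "schwartz = {\<phi>. smooth \<phi> \<and>
     (\<forall>k n. \<exists>C. \<forall>x. norm (of_real x ^ k * (vderiv ^^ n) \<phi> x) \<le> C)}"

definition Z_space :: "(real \<Rightarrow> complex) set" where
  "Z_space = {\<phi> \<in> schwartz. \<exists>f. f holomorphic_on UNIV \<and> (\<forall>x. f (of_real x) = \<phi> x) \<and>
     (\<exists>r>0. \<forall>n::nat. \<exists>C. \<forall>z. norm (f z) \<le> C * inverse ((1 + norm z) ^ n) * exp (r * \<bar>Im z\<bar>))}"

definition Z_topology :: "(real \<Rightarrow> complex) topology" where
  "Z_topology = pullback_topology Z_space fourier test_topology"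

text \<open>Functions on \<open>(0, \<infinity>)\<close> are encoded as functions on the real line vanishing
  on \<open>(-\<infinity>, 0]\<close>.\<close>
definition Zplus :: "(real \<Rightarrow> complex) set" where
  "Zplus = {F. (\<forall>t\<le>0. F t = 0) \<and> (\<lambda>x. F (exp x)) \<in> Z_space}"

definition Zplus_topology :: "(real \<Rightarrow> complex) topology" where
  "Zplus_topology = pullback_topology Zplus (\<lambda>F x. F (exp x)) Z_topology"


section \<open>Distributions\<close>

definition antilinear_on :: "(real \<Rightarrow> complex) set \<Rightarrow> ((real \<Rightarrow> complex) \<Rightarrow> complex) \<Rightarrow> bool" where
  "antilinear_on L f \<longleftrightarrow> (\<forall>u\<in>L. \<forall>v\<in>L. \<forall>a b.
     f (\<lambda>x. a * u x + b * v x) = cnj a * f u + cnj b * f v)"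

text \<open>The values of a functional outside \<open>Zplus\<close> are irrelevant.\<close>
definition Zplus_dual :: "((real \<Rightarrow> complex) \<Rightarrow> complex) set" where
  "Zplus_dual = {h. antilinear_on Zplus h \<and> continuous_map Zplus_topology euclidean h}"

text \<open>The distribution \<open>\<theta>(x) = e\<^sup>x h(e\<^sup>x)\<close>: the argument of \<open>h\<close> is the \<open>F\<close> in \<open>Zplus\<close>
  with \<open>\<Omega>(x) = F(e\<^sup>x)\<close>.\<close>
definition theta_dist ::
    "((real \<Rightarrow> complex) \<Rightarrow> complex) \<Rightarrow> (real \<Rightarrow> complex) \<Rightarrow> complex" where
  "theta_dist h = (\<lambda>\<Omega>. h (\<lambda>t. if t > 0 then \<Omega> (ln t) else 0))"

definition a_dist ::
    "((real \<Rightarrow> complex) \<Rightarrow> complex) \<Rightarrow> (real \<Rightarrow> complex) \<Rightarrow> complex" where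
  "a_dist h = (\<lambda>g. theta_dist h (fourier_adj g))"

text \<open>Multiplication of the distribution by \<open>1 / \<Gamma>(1 - \<i>\<xi>)\<close> is multiplication of the test
  function by the complex conjugate \<open>1 / \<Gamma>(1 + \<i>\<xi>)\<close>, functionals being antilinear.\<close>
definition b_dist ::
    "((real \<Rightarrow> complex) \<Rightarrow> complex) \<Rightarrow> (real \<Rightarrow> complex) \<Rightarrow> complex" where
  "b_dist h = (\<lambda>G. of_real ((2 * pi) powr (-1/2)) *
     a_dist h (\<lambda>\<xi>. inverse (Gamma (1 + \<i> * of_real \<xi>)) * G \<xi>))"

definition sign_function ::
    "((real \<Rightarrow> complex) \<Rightarrow> complex) \<Rightarrow> (real \<Rightarrow> complex) \<Rightarrow> complex" where
  "sign_function h = (\<lambda>\<phi>. of_real (sqrt (2 * pi)) * b_dist h (fourier \<phi>))"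

text \<open>The distribution \<open>\<lambda>\<^sup>-\<^sup>1 s(- ln \<lambda>)\<close> on \<open>(0, \<infinity>)\<close>.\<close>
definition natural_dist ::
    "((real \<Rightarrow> complex) \<Rightarrow> complex) \<Rightarrow> (real \<Rightarrow> complex) \<Rightarrow> complex" where
  "natural_dist s = (\<lambda>F. s (\<lambda>x. F (exp (- x))))"

definition L1 :: "(real \<Rightarrow> complex) \<Rightarrow> real \<Rightarrow> complex" where
  "L1 F = (\<lambda>l. if l > 0
     then of_real l * (LINT t:{0<..}|lborel. of_real (exp (- t * l)) * F t) else 0)"

end

(* A distribution h is sent by the construction to h o T, where in exponential variables T reflects
   x to -x and then multiplies the Fourier transform by 1 / Gamma(1 + i xi).  In the same variables
   L_1 is a convolution with the Gumbel kernel e^y exp(-e^y) followed by a reflection; the Fourier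
   transform of this kernel is Euler's integral for Gamma(1 + i xi).  Hence T L_1 = id on Z_+, which
   is the recovery formula.  Since Gamma(1 + i xi) has no zeros and its reciprocal is smooth,
   multiplication by it is continuous on test functions, and Fourier inversion together with the
   Paley-Wiener theorem transports this to the continuity of T on Z_+. *)
theory Submission
  imports Defs
    "HOL-Probability.Sinc_Integral"
    "HOL-Probability.Characteristic_Functions"
    "HOL-Complex_Analysis.Cauchy_Integral_Formula"
    "HOL-Real_Asymp.Real_Asymp"
begin

section \<open>Smooth functions of a real variable\<close>

text \<open>The factor 1 / Gamma(1 + i \<xi>) grows like exp(pi |\<xi>| / 2) up to a power of
  |\<xi>|, which reflects the instability of inverting a Laplace transform; Schwartz functions do
  not tolerate such a multiplier. Fourier transforms of functions in \<open>Z_space\<close> have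
  compact support, so on that side the growth is harmless and only smoothness of the factor counts.
  Both \<open>Z_topology\<close> and \<open>Zplus_topology\<close> are pullbacks of the topology of
  test functions, hence no seminorm on entire functions has to be estimated: all continuity
  estimates concern a reflection followed by a multiplication.\<close>

lemma smooth_differentiable: "smooth u \<Longrightarrow> u differentiable (at x)"
  unfolding smooth_def by (drule spec[of _ 0]) simp

lemma smooth_has_vector_derivative:
  assumes "smooth u"
  shows "(u has_vector_derivative vderiv u x) (at x)"
  using smooth_differentiable[OF assms] by (simp add: vderiv_def vector_derivative_works)

lemma vderiv_funpow_vderiv: "(vderiv ^^ n) (vderiv u) = (vderiv ^^ Suc n) u"
  by (simp add: funpow_swap1)

lemma smooth_vderiv: "smooth u \<Longrightarrow> smooth (vderiv u)"
  unfolding smooth_def vderiv_funpow_vderiv by blast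

lemma smooth_vderiv_funpow: "smooth u \<Longrightarrow> smooth ((vderiv ^^ n) u)"
  by (induction n) (auto intro: smooth_vderiv)

lemma smooth_continuous_on: "smooth u \<Longrightarrow> continuous_on S u"
  by (meson smooth_differentiable continuous_at_imp_continuous_on differentiable_imp_continuous_within)

lemma vderiv_eqI:
  assumes "\<And>x. (u has_vector_derivative u' x) (at x)"
  shows "vderiv u = u'"
  unfolding vderiv_def using vector_derivative_at[OF assms] by auto

text \<open>All iterates of \<open>vderiv\<close> stay in the class \<open>P\<close> by induction.
  It serves where a class closed under differentiation is easier to describe than an n-th
  derivative: sums of products, restrictions of entire functions, Fourier transforms.\<close>

lemma smooth_coinduct:
  assumes "P u" and step: "\<And>w. P w \<Longrightarrow> (\<forall>x. w differentiable (at x)) \<and> P (vderiv w)"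
  shows "smooth u"
proof -
  have "P ((vderiv ^^ n) u)" for n
    by (induction n) (use assms in auto)
  then show ?thesis
    using step by (auto simp: smooth_def)
qed

text \<open>The sums of products form a class closed under \<open>vderiv\<close>, so coinduction replaces
  the Leibniz formula.\<close>
inductive smooth_product_sum :: "(real \<Rightarrow> complex) \<Rightarrow> bool" where
  mult: "smooth u \<Longrightarrow> smooth v \<Longrightarrow> smooth_product_sum (\<lambda>x. u x * v x)"
| add: "smooth_product_sum u \<Longrightarrow> smooth_product_sum v \<Longrightarrow> smooth_product_sum (\<lambda>x. u x + v x)"

lemma vderiv_mult:
  assumes "smooth u" "smooth v"
  shows "vderiv (\<lambda>x. u x * v x) = (\<lambda>x. u x * vderiv v x + vderiv u x * v x)"
  by (intro vderiv_eqI has_vector_derivative_mult smooth_has_vector_derivative assms)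

lemma smooth_product_sum_vderiv:
  assumes "smooth_product_sum w"
  shows "(\<forall>x. w differentiable (at x)) \<and> smooth_product_sum (vderiv w)"
  using assms
proof induction
  case (mult u v)
  then show ?case
    by (auto simp: vderiv_mult intro!: smooth_product_sum.intros smooth_vderiv
        differentiable_mult intro: smooth_differentiable)
next
  case (add u v)
  then have "vderiv (\<lambda>x. u x + v x) = (\<lambda>x. vderiv u x + vderiv v x)"
    by (intro vderiv_eqI has_vector_derivative_add) (auto simp: vderiv_def vector_derivative_works)
  with add show ?case
    by (auto intro: smooth_product_sum.intros)
qed

lemma smooth_mult:
  assumes "smooth u" "smooth v"
  shows "smooth (\<lambda>x. u x * v x)"
  using smooth_product_sum_vderiv smooth_product_sum.mult[OF assms]
  by (rule smooth_coinduct[where P = smooth_product_sum, rotated])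

text \<open>Each differentiation of a product doubles the number of terms, and each term is at most
  \<open>B * d\<close>. The crude factor \<open>2 ^ k\<close> thus stands in for the binomial
  coefficients of the Leibniz formula.\<close>

lemma norm_vderiv_funpow_mult_le:
  assumes "smooth u" "smooth v"
    and "\<And>j. j \<le> k \<Longrightarrow> norm ((vderiv ^^ j) u x) \<le> B"
    and "\<And>j. j \<le> k \<Longrightarrow> norm ((vderiv ^^ j) v x) \<le> d"
  shows "norm ((vderiv ^^ k) (\<lambda>x. u x * v x) x) \<le> 2 ^ k * (B * d)"
  using assms
proof (induction k arbitrary: u v)
  case 0
  then show ?case
    using mult_mono[OF 0(3)[of 0] 0(4)[of 0] order_trans[OF norm_ge_zero 0(3)[of 0]]]
    by (simp add: norm_mult)
next
  case (Suc k)
  \<comment> \<open>The coefficients 1 bring the sum into the form of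
    \<open>vderiv_funpow_lincomb\<close>.\<close>
  have "(vderiv ^^ Suc k) (\<lambda>x. u x * v x) = (vderiv ^^ k) (\<lambda>x. 1 * (u x * vderiv v x) + 1 * (vderiv u x * v x))"
    using Suc.prems(1,2) by (simp add: funpow_Suc_right vderiv_mult del: funpow.simps)
  also have "\<dots> = (\<lambda>x. 1 * (vderiv ^^ k) (\<lambda>x. u x * vderiv v x) x + 1 * (vderiv ^^ k) (\<lambda>x. vderiv u x * v x) x)"
    using Suc.prems(1,2) by (intro vderiv_funpow_lincomb smooth_mult smooth_vderiv)
  finally have eq: "(vderiv ^^ Suc k) (\<lambda>x. u x * v x) x =
      (vderiv ^^ k) (\<lambda>x. u x * vderiv v x) x + (vderiv ^^ k) (\<lambda>x. vderiv u x * v x) x"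
    by simp
  have "norm ((vderiv ^^ k) (\<lambda>x. u x * vderiv v x) x) \<le> 2 ^ k * (B * d)"
    using Suc.prems by (intro Suc.IH smooth_vderiv) (auto simp only: vderiv_funpow_vderiv)
  moreover have "norm ((vderiv ^^ k) (\<lambda>x. vderiv u x * v x) x) \<le> 2 ^ k * (B * d)"
    using Suc.prems by (intro Suc.IH smooth_vderiv) (auto simp only: vderiv_funpow_vderiv)
  ultimately show ?case
    unfolding eq by (intro norm_triangle_le) simp
qed

lemma vderiv_funpow_reflect:
  assumes "smooth u"
  shows "(vderiv ^^ n) (\<lambda>x. u (- x)) = (\<lambda>x. (- 1) ^ n * (vderiv ^^ n) u (- x))"
proof (induction n)
  case (Suc n)
  have "((\<lambda>x. (- 1) ^ n * (vderiv ^^ n) u (- x)) has_vector_derivative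
      (- 1) ^ Suc n * (vderiv ^^ Suc n) u (- x)) (at x)" for x
  proof -
    have "(((vderiv ^^ n) u \<circ> uminus) has_vector_derivative (- 1) *\<^sub>R (vderiv ^^ Suc n) u (- x)) (at x)"
      using smooth_has_vector_derivative[OF smooth_vderiv_funpow[OF assms], of n "- x"]
      by (intro vector_diff_chain_at) (auto intro!: derivative_eq_intros)
    from has_vector_derivative_mult_right[OF this, of "(-1) ^ n"] show ?thesis
      by (simp add: o_def)
  qed
  from vderiv_eqI[OF this] Suc.IH show ?case by simp
qed simp

lemma smooth_reflect:
  assumes "smooth u"
  shows "smooth (\<lambda>x. u (- x))"
proof -
  have "(\<lambda>x. (- 1) ^ n * (vderiv ^^ n) u (- x)) differentiable (at x)" for n x
  proof -
    have "(vderiv ^^ n) u \<circ> uminus differentiable (at x)"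
      using smooth_differentiable[OF smooth_vderiv_funpow[OF assms]]
      by (intro differentiable_chain_at) auto
    then show ?thesis
      by (intro differentiable_mult) (auto simp: o_def)
  qed
  then show ?thesis
    unfolding smooth_def vderiv_funpow_reflect[OF assms] by blast
qed

text \<open>The complement of \<open>K\<close> is open, so a function vanishing there has zero
  derivative there: differentiation does not enlarge supports.\<close>

lemma vderiv_funpow_eq_0:
  assumes "closed K" "\<And>x. x \<notin> K \<Longrightarrow> u x = 0" "x \<notin> K"
  shows "(vderiv ^^ n) u x = 0"
  using assms(3)
proof (induction n arbitrary: x)
  case (Suc n)
  have "((vderiv ^^ n) u has_vector_derivative 0) (at x)"
    using Suc assms(1) by (intro has_vector_derivative_transform_within_open[of "\<lambda>x. 0" 0 x "- K",
        OF has_vector_derivative_const]) auto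
  then show ?case
    unfolding funpow.simps o_apply vderiv_def[of "(vderiv ^^ n) u"] by (rule vector_derivative_at)
qed (use assms in auto)

lemma vderiv_funpow_of_real:
  assumes "f holomorphic_on UNIV"
  shows "(vderiv ^^ n) (\<lambda>x. f (of_real x)) = (\<lambda>x. (deriv ^^ n) f (of_real x))"
proof (induction n)
  case (Suc n)
  have "(deriv ^^ n) f holomorphic_on UNIV"
    using assms by (intro holomorphic_higher_deriv) auto
  then have "((deriv ^^ n) f has_field_derivative (deriv ^^ Suc n) f z) (at z)" for z
    using holomorphic_derivI[of "(deriv ^^ n) f" UNIV z] by simp
  then have "vderiv (\<lambda>x. (deriv ^^ n) f (of_real x)) = (\<lambda>x. (deriv ^^ Suc n) f (of_real x))"
    by (intro vderiv_eqI has_vector_derivative_real_field)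
  with Suc.IH show ?case by simp
qed simp

lemma smooth_of_real:
  assumes "f holomorphic_on UNIV"
  shows "smooth (\<lambda>x. f (of_real x))"
proof (rule smooth_coinduct[where P = "\<lambda>w. \<exists>f. f holomorphic_on UNIV \<and> w = (\<lambda>x. f (of_real x))"])
  fix w :: "real \<Rightarrow> complex"
  assume "\<exists>f. f holomorphic_on UNIV \<and> w = (\<lambda>x. f (of_real x))"
  then obtain g where g: "g holomorphic_on UNIV" and w: "w = (\<lambda>x. g (of_real x))" by blast
  have "(g has_field_derivative deriv g z) (at z)" for z
    using g holomorphic_derivI by blast
  then have "(w has_vector_derivative deriv g (of_real x)) (at x)" for x
    unfolding w by (intro has_vector_derivative_real_field)
  moreover have "deriv g holomorphic_on UNIV"
    using g by (intro holomorphic_deriv) auto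
  ultimately show "(\<forall>x. w differentiable at x) \<and> (\<exists>f. f holomorphic_on UNIV \<and> vderiv w = (\<lambda>x. f (of_real x)))"
    using vderiv_eqI[of w "\<lambda>x. deriv g (of_real x)"]
    by (auto intro: differentiableI_vector)
qed (use assms in blast)

section \<open>Continuity on the space of test functions\<close>

text \<open>Together with \<open>test_functionsI\<close> this trades the compact closure for a
  symmetric bound on the support, a form that products and reflections visibly preserve.\<close>

lemma test_functions_supp_bounded:
  assumes "u \<in> test_functions"
  obtains r where "r > 0" "\<And>x. r < \<bar>x\<bar> \<Longrightarrow> u x = 0"
proof -
  have "bounded {x. u x \<noteq> 0}"
    using assms by (simp add: test_functions_def compact_closure)
  then obtain r where "r > 0" "\<And>x. u x \<noteq> 0 \<Longrightarrow> \<bar>x\<bar> \<le> r"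
    by (auto simp: bounded_pos)
  then show thesis
    using that by (metis not_le)
qed

lemma test_functionsI:
  assumes "smooth u" "\<And>x. r < \<bar>x\<bar> \<Longrightarrow> u x = 0"
  shows "u \<in> test_functions"
proof -
  have "bounded {x. u x \<noteq> 0}"
    using assms(2) by (intro boundedI[of _ r]) (auto simp: not_less[symmetric])
  then show ?thesis
    using assms(1) by (simp add: test_functions_def compact_closure)
qed

lemma test_functions_mult:
  assumes "smooth m" "u \<in> test_functions"
  shows "(\<lambda>x. m x * u x) \<in> test_functions"
proof -
  obtain r where "\<And>x. r < \<bar>x\<bar> \<Longrightarrow> u x = 0"
    using test_functions_supp_bounded[OF assms(2)] by blast
  with assms show ?thesis
    by (intro test_functionsI[of _ r] smooth_mult) (auto simp: test_functions_def)
qed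

lemma test_functions_reflect:
  assumes "u \<in> test_functions"
  shows "(\<lambda>x. u (- x)) \<in> test_functions"
proof -
  obtain r where "\<And>x. r < \<bar>x\<bar> \<Longrightarrow> u x = 0"
    using test_functions_supp_bounded[OF assms] by blast
  with assms show ?thesis
    by (intro test_functionsI[of _ r] smooth_reflect) (auto simp: test_functions_def)
qed

text \<open>For a linear map it suffices that preimages of basic neighbourhoods of zero are again
  basic. On functions supported in \<open>K\<close> this is a Leibniz estimate in which only the
  values of \<open>m\<close> on the compact set -\<open>K\<close> enter, so \<open>m\<close> may
  grow arbitrarily. The reflection is built in because the passage from \<lambda> to exp (- x)
  reflects the Fourier transform.\<close>

lemma continuous_map_test_mult_reflect:
  assumes m: "smooth m"
  shows "continuous_map test_topology test_topology (\<lambda>u x. m x * u (- x))"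
proof -
  define A where "A = (\<lambda>(u :: real \<Rightarrow> complex) x. m x * u (- x))"
  have A_lin: "A (\<lambda>x. a * u x + b * v x) = (\<lambda>x. a * A u x + b * A v x)" for a b u v
    by (simp add: A_def fun_eq_iff algebra_simps)
  have A_test: "A u \<in> test_functions" if "u \<in> test_functions" for u
    unfolding A_def using that by (intro test_functions_mult[OF m] test_functions_reflect)
  have nhd: "test_nhd0 {u \<in> test_functions. A u \<in> V}" if V: "test_nhd0 V" for V
    unfolding test_nhd0_def
  proof (intro conjI allI impI)
    show "absolutely_convex {u \<in> test_functions. A u \<in> V}"
      using V unfolding absolutely_convex_def test_nhd0_def
      by (auto simp: A_lin intro: test_functions_lincomb)
    fix K :: "real set"
    assume K: "compact K"
    then have K': "compact (uminus ` K)"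
      by (rule compact_negations)
    then obtain N e where e: "e > 0" "test_ball (uminus ` K) N e \<subseteq> V"
      using V unfolding test_nhd0_def by meson
    have "\<exists>B. \<forall>x\<in>uminus ` K. norm ((vderiv ^^ j) m x) \<le> B" for j
    proof -
      have "compact ((vderiv ^^ j) m ` (uminus ` K))"
        by (intro compact_continuous_image smooth_continuous_on smooth_vderiv_funpow m K')
      then have "bounded ((vderiv ^^ j) m ` (uminus ` K))"
        by (rule compact_imp_bounded)
      then show ?thesis
        by (auto simp: bounded_iff)
    qed
    then obtain B where B: "\<And>j x. x \<in> uminus ` K \<Longrightarrow> norm ((vderiv ^^ j) m x) \<le> B j"
      by metis
    \<comment> \<open>A single bound for all derivatives of \<open>m\<close> up to order
      \<open>N\<close>; the summand 1 makes it positive, so that one may divide by it.\<close>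
    define C where "C = 1 + (\<Sum>j\<le>N. \<bar>B j\<bar>)"
    have C: "norm ((vderiv ^^ j) m x) \<le> C" if "x \<in> uminus ` K" "j \<le> N" for j x
    proof -
      have "\<bar>B j\<bar> \<le> (\<Sum>j\<le>N. \<bar>B j\<bar>)"
        using that(2) by (intro member_le_sum) auto
      with B[OF that(1), of j] show ?thesis
        by (simp add: C_def)
    qed
    have "C > 0"
      unfolding C_def by (intro add_pos_nonneg sum_nonneg) auto
    \<comment> \<open>The factor \<open>2 ^ N * C\<close> is the loss in the Leibniz estimate, and
      the extra 2 makes the final inequality strict.\<close>
    define d where "d = e / (2 ^ N * C * 2)"
    have d: "d > 0" "2 ^ N * (C * d) < e"
      using \<open>e > 0\<close> \<open>C > 0\<close> by (auto simp: d_def)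
    have "A u \<in> test_ball (uminus ` K) N e" if u: "u \<in> test_ball K N d" for u
    proof -
      have su: "smooth u" and u0: "\<And>x. x \<notin> K \<Longrightarrow> u x = 0"
        and ud: "\<And>k x. k \<le> N \<Longrightarrow> norm ((vderiv ^^ k) u x) < d"
        using u by (auto simp: test_ball_def)
      have A0: "A u x = 0" if "x \<notin> uminus ` K" for x
      proof -
        have "- x \<notin> K"
          using that by (metis image_eqI minus_minus)
        then show ?thesis
          by (simp add: A_def u0)
      qed
      \<comment> \<open>The bound \<open>C\<close> holds on -\<open>K\<close> only; elsewhere all
        derivatives of \<open>A u\<close> vanish.\<close>
      have "norm ((vderiv ^^ k) (A u) x) < e" if "k \<le> N" for k x
      proof (cases "x \<in> uminus ` K")
        case True
        have "norm ((vderiv ^^ k) (A u) x) \<le> 2 ^ k * (C * d)"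
          unfolding A_def
          by (intro norm_vderiv_funpow_mult_le m smooth_reflect su)
             (use True C that ud in \<open>auto simp: vderiv_funpow_reflect[OF su] norm_mult norm_power
               intro!: less_imp_le\<close>)
        also have "\<dots> \<le> 2 ^ N * (C * d)"
          using that \<open>C > 0\<close> \<open>d > 0\<close> by (intro mult_right_mono power_increasing) auto
        finally show ?thesis
          using d by simp
      next
        case False
        then show ?thesis
          using vderiv_funpow_eq_0[OF compact_imp_closed[OF K'] A0 False] \<open>e > 0\<close> by simp
      qed
      moreover have "smooth (A u)"
        unfolding A_def by (intro smooth_mult m smooth_reflect su)
      ultimately show ?thesis
        using A0 by (auto simp: test_ball_def)
    qed
    with e test_ball_subset[OF K] d(1) show "\<exists>N. \<exists>e>0. test_ball K N e \<subseteq> {u \<in> test_functions. A u \<in> V}"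
      by (intro exI[of _ N] exI[of _ d]) auto
  qed auto
  have "openin test_topology {u \<in> topspace test_topology. A u \<in> U}" if U: "openin test_topology U" for U
    unfolding openin_test_topology topspace_test_topology test_open_def
  proof (intro conjI ballI)
    fix u
    assume "u \<in> {u \<in> test_functions. A u \<in> U}"
    then have u: "u \<in> test_functions" "A u \<in> U"
      by auto
    then obtain V where V: "test_nhd0 V" "\<And>v. v \<in> V \<Longrightarrow> (\<lambda>x. A u x + v x) \<in> U"
      using U unfolding openin_test_topology test_open_def by meson
    have "(\<lambda>x. u x + v x) \<in> {u \<in> test_functions. A u \<in> U}"
      if "v \<in> {u \<in> test_functions. A u \<in> V}" for v
      using that V(2) A_lin[of 1 u 1 v] test_functions_lincomb[OF u(1), of v 1 1] by auto
    with nhd[OF V(1)] show "\<exists>V. test_nhd0 V \<and> (\<forall>v\<in>V. (\<lambda>x. u x + v x) \<in> {u \<in> test_functions. A u \<in> U})"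
      by blast
  qed auto
  then have "continuous_map test_topology test_topology A"
    using A_test by (auto simp: continuous_map_def topspace_test_topology)
  then show ?thesis
    by (simp add: A_def)
qed

section \<open>Fourier inversion\<close>

lemma pair_sigma_finite_lborel: "pair_sigma_finite (lborel :: real measure) (lborel :: real measure)"
  by unfold_locales

text \<open>The product \<open>a x * b y\<close> is integrable by Tonelli, and the bounded factor
  \<open>k\<close>, later an oscillating exponential, preserves this.\<close>

lemma integrable_tensor_mult_bounded:
  fixes a b :: "real \<Rightarrow> complex" and k :: "real \<times> real \<Rightarrow> complex"
  assumes a: "integrable lborel a" and b: "integrable lborel b"
    and k: "k \<in> borel_measurable borel" and k1: "\<And>p. norm (k p) \<le> 1"
  shows "integrable (lborel \<Otimes>\<^sub>M lborel) (\<lambda>(x, y). a x * b y * k (x, y))"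
proof -
  have [measurable]: "a \<in> borel_measurable borel" "b \<in> borel_measurable borel"
    using a b by auto
  have k' [measurable]: "k \<in> borel_measurable (borel \<Otimes>\<^sub>M borel)"
    using k by (simp add: borel_prod)
  have "integrable (lborel \<Otimes>\<^sub>M lborel) (\<lambda>(x, y). a x * b y)"
  proof (rule pair_sigma_finite.Fubini_integrable[OF pair_sigma_finite_lborel])
    have "integrable lborel (\<lambda>x. norm (a x) * (\<integral>y. norm (b y) \<partial>lborel))"
      using a by (intro integrable_mult_left integrable_norm) auto
    then show "integrable lborel (\<lambda>x. \<integral>y. norm (case (x, y) of (x, y) \<Rightarrow> a x * b y) \<partial>lborel)"
      by (simp add: norm_mult)
  qed (use b in auto)
  then show ?thesis
    by (rule Bochner_Integration.integrable_bound)
       (use k1 in \<open>auto simp: norm_mult intro!: AE_I2 mult_left_le\<close>)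
qed

lemma Fubini_tensor_mult_bounded:
  fixes a b :: "real \<Rightarrow> complex" and k :: "real \<times> real \<Rightarrow> complex"
  assumes "integrable lborel a" "integrable lborel b"
    and "k \<in> borel_measurable borel" "\<And>p. norm (k p) \<le> 1"
  shows "(LINT y|lborel. LINT x|lborel. a x * b y * k (x, y)) =
    (LINT x|lborel. LINT y|lborel. a x * b y * k (x, y))"
  using pair_sigma_finite.Fubini_integral[OF pair_sigma_finite_lborel,
      OF integrable_tensor_mult_bounded[OF assms]] .

lemma norm_exp_i_of_real [simp]:
  "norm (exp (\<i> * of_real x * of_real y)) = 1" "norm (exp (- \<i> * of_real x * of_real y)) = 1"
  "norm (exp (- (\<i> * of_real x * of_real y))) = 1"
  by (simp_all add: norm_exp_eq_Re)

section \<open>Gaussian integrals and the regularised inversion formula\<close>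

lemma gaussian_integral:
  "integrable lborel (\<lambda>v::real. complex_of_real (exp (- v\<^sup>2 / 2)))"
  "(LINT v|lborel. complex_of_real (exp (- v\<^sup>2 / 2))) = of_real (sqrt (2 * pi))"
proof -
  have eq: "complex_of_real (exp (- v\<^sup>2 / 2)) = of_real (sqrt (2 * pi)) * of_real (std_normal_density v)" for v
    by (simp only: std_normal_density_def of_real_mult[symmetric]) simp
  have i: "integrable lborel std_normal_density"
    using integrable_std_normal_moment[of 0] by simp
  then show "integrable lborel (\<lambda>v::real. complex_of_real (exp (- v\<^sup>2 / 2)))"
    unfolding eq by (intro integrable_mult_right integrable_of_real)
  show "(LINT v|lborel. complex_of_real (exp (- v\<^sup>2 / 2))) = of_real (sqrt (2 * pi))"
    unfolding eq using integral_std_normal_moment_even[of 0] by simp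
qed

text \<open>Up to the factor sqrt(2 pi) this is the characteristic function of the standard normal
  distribution.\<close>

lemma gaussian_fourier:
  "(LINT v|lborel. complex_of_real (exp (- v\<^sup>2 / 2)) * exp (\<i> * of_real t * of_real v)) =
    of_real (sqrt (2 * pi) * exp (- t\<^sup>2 / 2))"
proof -
  have "complex_of_real (exp (- v\<^sup>2 / 2)) = of_real (sqrt (2 * pi)) * of_real (std_normal_density v)" for v
    by (simp only: std_normal_density_def of_real_mult[symmetric]) simp
  then have "(LINT v|lborel. complex_of_real (exp (- v\<^sup>2 / 2)) * exp (\<i> * of_real t * of_real v)) =
    of_real (sqrt (2 * pi)) * (LINT v|lborel. std_normal_density v *\<^sub>R iexp (t * v))"
    unfolding integral_mult_right_zero[symmetric]
    by (intro Bochner_Integration.integral_cong refl) (simp add: scaleR_conv_of_real mult_ac)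
  also have "(LINT v|lborel. std_normal_density v *\<^sub>R iexp (t * v)) = char std_normal_distribution t"
    unfolding char_def by (subst integral_density) auto
  finally show ?thesis
    unfolding char_std_normal_distribution by simp
qed

text \<open>The substitution v = \<epsilon> \<xi> reduces to the standard Gaussian at frequency w /
  \<epsilon>.\<close>

lemma gaussian_fourier_scaled:
  assumes "\<epsilon> > 0"
  shows "integrable lborel (\<lambda>\<xi>. complex_of_real (exp (- (\<epsilon> * \<xi>)\<^sup>2 / 2)))"
    and "(LINT \<xi>|lborel. complex_of_real (exp (- (\<epsilon> * \<xi>)\<^sup>2 / 2)) * exp (\<i> * of_real w * of_real \<xi>)) =
      of_real (sqrt (2 * pi) / \<epsilon> * exp (- (w / \<epsilon>)\<^sup>2 / 2))"
proof -
  show "integrable lborel (\<lambda>\<xi>. complex_of_real (exp (- (\<epsilon> * \<xi>)\<^sup>2 / 2)))"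
    using lborel_integrable_real_affine[OF gaussian_integral(1), of \<epsilon> 0] assms by simp
  have "of_real (sqrt (2 * pi) * exp (- (w / \<epsilon>)\<^sup>2 / 2)) =
    \<epsilon> *\<^sub>R (LINT \<xi>|lborel. complex_of_real (exp (- (\<epsilon> * \<xi>)\<^sup>2 / 2)) *
      exp (\<i> * of_real (w / \<epsilon>) * of_real (\<epsilon> * \<xi>)))"
    unfolding gaussian_fourier[symmetric]
    by (subst lborel_integral_real_affine[where c = \<epsilon> and t = 0]) (use assms in auto)
  also have "(\<lambda>\<xi>. \<i> * of_real (w / \<epsilon>) * complex_of_real (\<epsilon> * \<xi>)) = (\<lambda>\<xi>. \<i> * of_real w * of_real \<xi>)"
    using assms by auto
  finally show "(LINT \<xi>|lborel. complex_of_real (exp (- (\<epsilon> * \<xi>)\<^sup>2 / 2)) * exp (\<i> * of_real w * of_real \<xi>)) =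
      of_real (sqrt (2 * pi) / \<epsilon> * exp (- (w / \<epsilon>)\<^sup>2 / 2))"
    using assms by (simp add: scaleR_conv_of_real field_simps)
qed

text \<open>Reconciles the two spellings of the normalisation. It is used for Fourier inversion and
  again for the cancellation of constants in the sign-function.\<close>

lemma sqrt_2pi_powr: "complex_of_real ((2 * pi) powr (-1/2)) * of_real (sqrt (2 * pi)) = 1"
proof -
  have "(2 * pi) powr (-1/2) * sqrt (2 * pi) = 1"
    by (simp add: powr_half_sqrt[symmetric] powr_add[symmetric] del: real_sqrt_mult)
  then show ?thesis
    unfolding of_real_mult[symmetric] by simp
qed

text \<open>The factor \<open>exp (- (\<epsilon> * \<xi>)\<^sup>2 / 2)\<close> makes Fubini applicable; inversion is the limit
  \<open>\<epsilon> \<longlonglongrightarrow> 0\<close> of this identity.\<close>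
lemma gaussian_smoothing:
  fixes f :: "real \<Rightarrow> complex"
  assumes f: "integrable lborel f" and "\<epsilon> > 0"
  shows "(LINT \<xi>|lborel. fourier f \<xi> * exp (\<i> * of_real x * of_real \<xi>) * of_real (exp (- (\<epsilon> * \<xi>)\<^sup>2 / 2))) =
    (LINT u|lborel. f (x + \<epsilon> * u) * of_real (exp (- u\<^sup>2 / 2)))"
proof -
  define c where "c = complex_of_real ((2 * pi) powr (-1/2))"
  define g where "g = (\<lambda>\<xi>. complex_of_real (exp (- (\<epsilon> * \<xi>)\<^sup>2 / 2)))"
  define k where "k = (\<lambda>p :: real \<times> real. exp (\<i> * of_real (x - snd p) * of_real (fst p)))"
  have g: "integrable lborel g"
    unfolding g_def by (rule gaussian_fourier_scaled(1)[OF \<open>\<epsilon> > 0\<close>])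
  have [measurable]: "f \<in> borel_measurable borel"
    using f by auto
  have k: "k \<in> borel_measurable borel"
    unfolding k_def by (intro borel_measurable_continuous_onI continuous_intros)
  have "(LINT \<xi>|lborel. fourier f \<xi> * exp (\<i> * of_real x * of_real \<xi>) * of_real (exp (- (\<epsilon> * \<xi>)\<^sup>2 / 2))) =
    (LINT \<xi>|lborel. c * (LINT y|lborel. g \<xi> * f y * k (\<xi>, y)))"
  proof (intro Bochner_Integration.integral_cong refl)
    fix \<xi> :: real
    have "g \<xi> * f y * k (\<xi>, y) =
        (f y * exp (- \<i> * of_real y * of_real \<xi>)) * (exp (\<i> * of_real x * of_real \<xi>) * g \<xi>)" for y
      by (simp add: k_def algebra_simps flip: exp_add)
    then have "(LINT y|lborel. g \<xi> * f y * k (\<xi>, y)) =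
        (LINT y|lborel. f y * exp (- \<i> * of_real y * of_real \<xi>)) * (exp (\<i> * of_real x * of_real \<xi>) * g \<xi>)"
      by (simp only: integral_mult_left_zero)
    then show "fourier f \<xi> * exp (\<i> * of_real x * of_real \<xi>) * of_real (exp (- (\<epsilon> * \<xi>)\<^sup>2 / 2)) =
        c * (LINT y|lborel. g \<xi> * f y * k (\<xi>, y))"
      by (simp add: fourier_def c_def g_def mult_ac)
  qed
  also have "\<dots> = c * (LINT y|lborel. LINT \<xi>|lborel. g \<xi> * f y * k (\<xi>, y))"
    using Fubini_tensor_mult_bounded[OF g f k]
    by (simp add: k_def norm_exp_eq_Re)
  also have "(LINT y|lborel. LINT \<xi>|lborel. g \<xi> * f y * k (\<xi>, y)) =
      (LINT y|lborel. f y * of_real (sqrt (2 * pi) / \<epsilon> * exp (- ((x - y) / \<epsilon>)\<^sup>2 / 2)))"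
  proof (intro Bochner_Integration.integral_cong refl)
    fix y :: real
    have "(LINT \<xi>|lborel. g \<xi> * f y * k (\<xi>, y)) =
        f y * (LINT \<xi>|lborel. g \<xi> * exp (\<i> * of_real (x - y) * of_real \<xi>))"
      by (subst integral_mult_right_zero[symmetric]) (simp add: k_def mult_ac)
    also have "(LINT \<xi>|lborel. g \<xi> * exp (\<i> * of_real (x - y) * of_real \<xi>)) =
        of_real (sqrt (2 * pi) / \<epsilon> * exp (- ((x - y) / \<epsilon>)\<^sup>2 / 2))"
      unfolding g_def by (rule gaussian_fourier_scaled(2)[OF \<open>\<epsilon> > 0\<close>])
    finally show "(LINT \<xi>|lborel. g \<xi> * f y * k (\<xi>, y)) =
        f y * of_real (sqrt (2 * pi) / \<epsilon> * exp (- ((x - y) / \<epsilon>)\<^sup>2 / 2))" .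
  qed
  \<comment> \<open>Substituting y = x + \<epsilon> u produces the factor \<epsilon> that cancels 1
    / \<epsilon>: what remains is a Gaussian average of f over a window of width \<epsilon> around
    x.\<close>
  also have "\<dots> = \<epsilon> *\<^sub>R (LINT u|lborel. f (x + \<epsilon> * u) * of_real (sqrt (2 * pi) / \<epsilon> * exp (- ((x - (x + \<epsilon> * u)) / \<epsilon>)\<^sup>2 / 2)))"
    using \<open>\<epsilon> > 0\<close> by (subst lborel_integral_real_affine[where c = \<epsilon> and t = x]) auto
  also have "\<dots> = of_real (sqrt (2 * pi)) * (LINT u|lborel. f (x + \<epsilon> * u) * of_real (exp (- u\<^sup>2 / 2)))"
    unfolding integral_scaleR_right[symmetric] integral_mult_right_zero[symmetric]
    using \<open>\<epsilon> > 0\<close>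
    by (intro Bochner_Integration.integral_cong refl) (simp add: scaleR_conv_of_real)
  finally show ?thesis
    using sqrt_2pi_powr by (simp add: c_def flip: mult.assoc)
qed

text \<open>Dominated convergence on both sides of \<open>gaussian_smoothing\<close>: integrability
  of \<open>fourier f\<close> gives the majorant on the left, the bound \<open>B\<close> the
  Gaussian majorant on the right, and continuity identifies the limit there as f x times the
  Gaussian integral.\<close>

theorem fourier_inversion:
  fixes f :: "real \<Rightarrow> complex"
  assumes f: "integrable lborel f" and cont: "continuous_on UNIV f" and B: "\<And>x. norm (f x) \<le> B"
    and ff: "integrable lborel (fourier f)"
  shows "fourier_adj (fourier f) x = f x"
proof -
  define \<epsilon> where "\<epsilon> = (\<lambda>n. 1 / real (Suc n))"
  have \<epsilon>: "\<epsilon> n > 0" "\<epsilon> \<longlonglongrightarrow> 0" for n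
    unfolding \<epsilon>_def using LIMSEQ_Suc[OF lim_1_over_n] by auto
  have [measurable]: "f \<in> borel_measurable borel" "fourier f \<in> borel_measurable borel"
    using f ff by auto
  have "(\<lambda>n. LINT \<xi>|lborel. fourier f \<xi> * exp (\<i> * of_real x * of_real \<xi>) * of_real (exp (- (\<epsilon> n * \<xi>)\<^sup>2 / 2)))
      \<longlonglongrightarrow> (LINT \<xi>|lborel. fourier f \<xi> * exp (\<i> * of_real x * of_real \<xi>))"
  proof (rule integral_dominated_convergence[where w = "\<lambda>\<xi>. norm (fourier f \<xi>)"])
    show "AE \<xi> in lborel. (\<lambda>n. fourier f \<xi> * exp (\<i> * of_real x * of_real \<xi>) * of_real (exp (- (\<epsilon> n * \<xi>)\<^sup>2 / 2)))
        \<longlonglongrightarrow> fourier f \<xi> * exp (\<i> * of_real x * of_real \<xi>)"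
    proof (intro AE_I2)
      fix \<xi> :: real
      have "(\<lambda>n. fourier f \<xi> * exp (\<i> * of_real x * of_real \<xi>) * of_real (exp (- (\<epsilon> n * \<xi>)\<^sup>2 / 2)))
        \<longlonglongrightarrow> fourier f \<xi> * exp (\<i> * of_real x * of_real \<xi>) * of_real (exp (- (0 * \<xi>)\<^sup>2 / 2))"
        by (intro tendsto_intros \<epsilon>(2)) auto
      then show "(\<lambda>n. fourier f \<xi> * exp (\<i> * of_real x * of_real \<xi>) * of_real (exp (- (\<epsilon> n * \<xi>)\<^sup>2 / 2)))
        \<longlonglongrightarrow> fourier f \<xi> * exp (\<i> * of_real x * of_real \<xi>)" by simp
    qed
    show "AE \<xi> in lborel. norm (fourier f \<xi> * exp (\<i> * of_real x * of_real \<xi>) * of_real (exp (- (\<epsilon> n * \<xi>)\<^sup>2 / 2)))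
        \<le> norm (fourier f \<xi>)" for n
      by (auto simp: norm_mult intro!: mult_left_le)
  qed (use ff in auto)
  moreover have "(\<lambda>n. LINT u|lborel. f (x + \<epsilon> n * u) * of_real (exp (- u\<^sup>2 / 2)))
      \<longlonglongrightarrow> (LINT u|lborel. f x * of_real (exp (- u\<^sup>2 / 2)))"
  proof (rule integral_dominated_convergence[where w = "\<lambda>u. B * exp (- u\<^sup>2 / 2)"])
    have "integrable lborel (\<lambda>u. Re (complex_of_real (exp (- u\<^sup>2 / 2))))"
      by (intro integrable_Re gaussian_integral)
    then show "integrable lborel (\<lambda>u::real. B * exp (- u\<^sup>2 / 2))"
      by (intro integrable_mult_right) simp
    show "AE u in lborel. (\<lambda>n. f (x + \<epsilon> n * u) * of_real (exp (- u\<^sup>2 / 2)))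
        \<longlonglongrightarrow> f x * of_real (exp (- u\<^sup>2 / 2))"
    proof (intro AE_I2 tendsto_mult tendsto_const)
      fix u :: real
      have "(\<lambda>n. x + \<epsilon> n * u) \<longlonglongrightarrow> x + 0 * u"
        by (intro tendsto_intros \<epsilon>(2))
      moreover have "isCont f x"
        using cont by (simp add: continuous_on_eq_continuous_at)
      ultimately show "(\<lambda>n. f (x + \<epsilon> n * u)) \<longlonglongrightarrow> f x"
        by (auto intro: isCont_tendsto_compose)
    qed
    show "AE u in lborel. norm (f (x + \<epsilon> n * u) * of_real (exp (- u\<^sup>2 / 2))) \<le> B * exp (- u\<^sup>2 / 2)" for n
      by (auto simp: norm_mult B intro!: mult_right_mono)
  qed auto
  ultimately have "(LINT \<xi>|lborel. fourier f \<xi> * exp (\<i> * of_real x * of_real \<xi>)) =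
      (LINT u|lborel. f x * of_real (exp (- u\<^sup>2 / 2)))"
    unfolding gaussian_smoothing[OF f \<epsilon>(1)] by (rule LIMSEQ_unique)
  then have "(LINT \<xi>|lborel. fourier f \<xi> * exp (\<i> * of_real x * of_real \<xi>)) = f x * of_real (sqrt (2 * pi))"
    using gaussian_integral(2) by simp
  then show ?thesis
    using sqrt_2pi_powr by (simp add: fourier_adj_def mult_ac)
qed

lemma fourier_adj_eq_fourier: "fourier_adj g x = fourier g (- x)"
  by (simp add: fourier_adj_def fourier_def mult_ac)

lemma fourier_reflect: "fourier (\<lambda>x. f (- x)) \<xi> = fourier f (- \<xi>)"
proof -
  have "(LINT x|lborel. f x * exp (- \<i> * of_real x * of_real (- \<xi>))) =
    (LINT x|lborel. f (- x) * exp (- \<i> * of_real x * of_real \<xi>))"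
    by (subst lborel_integral_real_affine[where c = "-1" and t = 0]) auto
  then show ?thesis
    by (simp add: fourier_def)
qed

text \<open>The adjoint is the transform followed by a reflection, and reflections commute with the
  transform, so this is the previous inversion theorem applied to \<open>g\<close>.\<close>

theorem fourier_adj_inversion:
  fixes g :: "real \<Rightarrow> complex"
  assumes "integrable lborel g" "continuous_on UNIV g" "\<And>x. norm (g x) \<le> B"
    and "integrable lborel (fourier_adj g)"
  shows "fourier (fourier_adj g) x = g x"
proof -
  have "fourier_adj g = (\<lambda>x. fourier g (- x))"
    by (simp add: fun_eq_iff fourier_adj_eq_fourier)
  moreover from this have "integrable lborel (fourier g)"
    using lborel_integrable_real_affine[OF assms(4), of "-1" 0] by simp
  ultimately show ?thesis
    using fourier_inversion[OF assms(1-3)] by (simp add: fourier_reflect fourier_adj_eq_fourier)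
qed

section \<open>The Paley-Wiener theorem\<close>

text \<open>For g supported in [-r, r] this is the entire extension of \<open>fourier_adj g\<close>
  without its normalising constant. The compact interval allows complex z and differentiation under
  the integral sign.\<close>

definition pw_extension :: "real \<Rightarrow> (real \<Rightarrow> complex) \<Rightarrow> complex \<Rightarrow> complex" where
  "pw_extension r g z = integral {-r..r} (\<lambda>\<xi>. g \<xi> * exp (\<i> * z * of_real \<xi>))"

lemma pw_extension_has_field_derivative:
  assumes "continuous_on UNIV g"
  shows "(pw_extension r g has_field_derivative pw_extension r (\<lambda>\<xi>. \<i> * of_real \<xi> * g \<xi>) z) (at z)"
proof -
  have g: "continuous_on S (\<lambda>x. g (h x))" if "continuous_on S h" for S and h :: "'a::topological_space \<Rightarrow> real"
    using that assms continuous_on_compose2 by blast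
  have "((\<lambda>z. integral (cbox (- r) r) (\<lambda>\<xi>. g \<xi> * exp (\<i> * z * of_real \<xi>))) has_field_derivative
      integral (cbox (- r) r) (\<lambda>\<xi>. \<i> * of_real \<xi> * g \<xi> * exp (\<i> * z * of_real \<xi>))) (at z within UNIV)"
  proof (rule leibniz_rule_field_derivative)
    show "(\<lambda>\<xi>. g \<xi> * exp (\<i> * z * of_real \<xi>)) integrable_on cbox (- r) r" for z
      by (intro integrable_continuous continuous_intros g)
    show "continuous_on (UNIV \<times> cbox (- r) r) (\<lambda>(z, \<xi>). \<i> * of_real \<xi> * g \<xi> * exp (\<i> * z * of_real \<xi>))"
      unfolding case_prod_beta by (intro continuous_intros g)
  qed (auto intro!: derivative_eq_intros)
  then show ?thesis
    by (simp add: pw_extension_def[abs_def])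
qed

lemma pw_extension_holomorphic:
  "continuous_on UNIV g \<Longrightarrow> pw_extension r g holomorphic_on UNIV"
  using pw_extension_has_field_derivative by (subst holomorphic_on_open) auto

lemma pw_extension_higher_deriv:
  assumes "continuous_on UNIV g"
  shows "(deriv ^^ n) (\<lambda>z. c * pw_extension r g z) =
    (\<lambda>z. c * pw_extension r (\<lambda>\<xi>. (\<i> * of_real \<xi>) ^ n * g \<xi>) z)"
proof (induction n)
  case (Suc n)
  have "continuous_on UNIV (\<lambda>\<xi>. (\<i> * of_real \<xi>) ^ n * g \<xi>)"
    by (intro continuous_intros assms)
  from pw_extension_has_field_derivative[OF this, of r]
  have "deriv (\<lambda>z. c * pw_extension r (\<lambda>\<xi>. (\<i> * of_real \<xi>) ^ n * g \<xi>) z) =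
      (\<lambda>z. c * pw_extension r (\<lambda>\<xi>. (\<i> * of_real \<xi>) ^ Suc n * g \<xi>) z)"
    by (intro ext DERIV_imp_deriv DERIV_cmult) (simp add: mult.assoc)
  with Suc.IH show ?case
    by simp
qed simp

text \<open>Integration by parts, with boundary terms killed by g (- r) = g r = 0. Each application
  trades a factor z for a derivative of g.\<close>

lemma pw_extension_by_parts:
  assumes g: "smooth g" "g (- r) = 0" "g r = 0" and "r > 0"
  shows "z * pw_extension r g z = pw_extension r (\<lambda>\<xi>. \<i> * vderiv g \<xi>) z"
proof -
  note [continuous_intros] = smooth_continuous_on[OF g(1)] smooth_continuous_on[OF smooth_vderiv[OF g(1)]]
  have "((\<lambda>\<xi>. g \<xi> * exp (\<i> * z * of_real \<xi>)) has_vector_derivative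
      g \<xi> * (\<i> * z * exp (\<i> * z * of_real \<xi>)) + vderiv g \<xi> * exp (\<i> * z * of_real \<xi>)) (at \<xi>)" for \<xi>
    by (intro has_vector_derivative_mult smooth_has_vector_derivative g has_vector_derivative_real_field)
       (auto intro!: derivative_eq_intros)
  then have "((\<lambda>\<xi>. g \<xi> * (\<i> * z * exp (\<i> * z * of_real \<xi>)) + vderiv g \<xi> * exp (\<i> * z * of_real \<xi>))
      has_integral g r * exp (\<i> * z * of_real r) - g (- r) * exp (\<i> * z * of_real (- r))) {- r..r}"
    using \<open>r > 0\<close>
    by (intro fundamental_theorem_of_calculus) (auto intro: has_vector_derivative_at_within)
  then have "integral {- r..r} (\<lambda>\<xi>. g \<xi> * (\<i> * z * exp (\<i> * z * of_real \<xi>)) + vderiv g \<xi> * exp (\<i> * z * of_real \<xi>)) = 0"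
    by (simp add: g integral_unique)
  also have "integral {- r..r} (\<lambda>\<xi>. g \<xi> * (\<i> * z * exp (\<i> * z * of_real \<xi>)) + vderiv g \<xi> * exp (\<i> * z * of_real \<xi>)) =
      integral {- r..r} (\<lambda>\<xi>. (\<i> * z) * (g \<xi> * exp (\<i> * z * of_real \<xi>))) +
      integral {- r..r} (\<lambda>\<xi>. vderiv g \<xi> * exp (\<i> * z * of_real \<xi>))"
    by (subst integral_add[symmetric])
       (auto intro!: integrable_continuous_real continuous_intros simp: mult_ac)
  also have "integral {- r..r} (\<lambda>\<xi>. (\<i> * z) * (g \<xi> * exp (\<i> * z * of_real \<xi>))) = \<i> * z * pw_extension r g z"
    unfolding pw_extension_def by (rule integral_mult_right)
  finally have eq: "\<i> * z * pw_extension r g z = - integral {- r..r} (\<lambda>\<xi>. vderiv g \<xi> * exp (\<i> * z * of_real \<xi>))"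
    by (simp add: eq_neg_iff_add_eq_0)
  have "z * pw_extension r g z = - \<i> * (\<i> * z * pw_extension r g z)"
    by (simp add: algebra_simps)
  also have "\<dots> = \<i> * integral {- r..r} (\<lambda>\<xi>. vderiv g \<xi> * exp (\<i> * z * of_real \<xi>))"
    unfolding eq by simp
  also have "\<dots> = pw_extension r (\<lambda>\<xi>. \<i> * vderiv g \<xi>) z"
    unfolding pw_extension_def by (subst integral_mult_right[symmetric]) (simp add: mult_ac)
  finally show ?thesis .
qed

text \<open>On the interval, |exp(i z \<xi>)| = exp(- \<xi> Im z) is at most exp(r |Im z|), and the
  interval has length 2 r.\<close>

lemma pw_extension_norm_le:
  assumes g: "continuous_on UNIV g" and B: "\<And>\<xi>. \<xi> \<in> {-r..r} \<Longrightarrow> norm (g \<xi>) \<le> B" and "r > 0"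
  shows "norm (pw_extension r g z) \<le> B * (2 * r) * exp (r * \<bar>Im z\<bar>)"
proof -
  have "norm (pw_extension r g z) \<le> B * exp (r * \<bar>Im z\<bar>) * (r - (- r))"
    unfolding pw_extension_def
  proof (rule integral_bound)
    show "continuous_on {-r..r} (\<lambda>\<xi>. g \<xi> * exp (\<i> * z * of_real \<xi>))"
      using continuous_on_subset[OF g] by (intro continuous_intros) auto
    fix \<xi>
    assume \<xi>: "\<xi> \<in> {-r..r}"
    have "\<bar>\<xi>\<bar> * \<bar>Im z\<bar> \<le> r * \<bar>Im z\<bar>"
      using \<xi> by (intro mult_right_mono) auto
    then have "- (Im z * \<xi>) \<le> r * \<bar>Im z\<bar>"
      using abs_le_D2[of "Im z * \<xi>" "\<bar>\<xi>\<bar> * \<bar>Im z\<bar>"] by (simp add: abs_mult mult.commute)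
    then show "norm (g \<xi> * exp (\<i> * z * of_real \<xi>)) \<le> B * exp (r * \<bar>Im z\<bar>)"
      using B[OF \<xi>] order_trans[OF norm_ge_zero B[OF \<xi>]]
      by (auto simp: norm_mult intro!: mult_mono)
  qed (use \<open>r > 0\<close> in auto)
  then show ?thesis
    by (simp add: mult_ac)
qed

text \<open>Induction on k over all g at once, replacing g by i g' at each step. The strict
  inequality \<open>r0 < r\<close> makes g and all its derivatives vanish at the endpoints.\<close>

lemma pw_extension_power_bound:
  assumes g: "smooth g" "\<And>x. r0 < \<bar>x\<bar> \<Longrightarrow> g x = 0" and r: "0 < r0" "r0 < r"
  shows "\<exists>C. \<forall>z. norm (z ^ k * pw_extension r g z) \<le> C * exp (r * \<bar>Im z\<bar>)"
  using g
proof (induction k arbitrary: g)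
  case 0
  have "continuous_on {-r..r} g"
    using 0 by (intro smooth_continuous_on)
  then have "bounded (g ` {-r..r})"
    by (intro compact_imp_bounded compact_continuous_image) auto
  then obtain B where "\<And>\<xi>. \<xi> \<in> {-r..r} \<Longrightarrow> norm (g \<xi>) \<le> B"
    unfolding bounded_iff by blast
  with 0 r pw_extension_norm_le[of g r B] show ?case
    by (auto intro: smooth_continuous_on)
next
  case (Suc k)
  have eq: "z ^ Suc k * pw_extension r g z = z ^ k * pw_extension r (\<lambda>\<xi>. \<i> * vderiv g \<xi>) z" for z
  proof -
    have "z * pw_extension r g z = pw_extension r (\<lambda>\<xi>. \<i> * vderiv g \<xi>) z"
      using Suc.prems r by (intro pw_extension_by_parts) auto
    then show ?thesis
      by (simp add: mult_ac)
  qed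
  \<comment> \<open>The zero summand only serves to apply \<open>smooth_lincomb\<close>.\<close>
  have "smooth (\<lambda>\<xi>. \<i> * vderiv g \<xi> + 0 * vderiv g \<xi>)"
    using Suc.prems by (intro smooth_lincomb smooth_vderiv)
  then have "smooth (\<lambda>\<xi>. \<i> * vderiv g \<xi>)"
    by simp
  moreover have "\<i> * vderiv g x = 0" if "r0 < \<bar>x\<bar>" for x
  proof -
    have "g y = 0" if "y \<notin> {-r0..r0}" for y
      using that by (intro Suc.prems(2)) auto
    moreover have "x \<notin> {-r0..r0}"
      using that by auto
    ultimately show ?thesis
      using vderiv_funpow_eq_0[of "{-r0..r0}" g x 1] by simp
  qed
  ultimately show ?case
    unfolding eq by (intro Suc.IH)
qed

lemma fourier_adj_eq_pw_extension:
  assumes g: "continuous_on UNIV g" "\<And>x. r < \<bar>x\<bar> \<Longrightarrow> g x = 0"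
  shows "fourier_adj g x = of_real ((2 * pi) powr (-1/2)) * pw_extension r g (of_real x)"
proof -
  have "set_integrable lborel {-r..r} (\<lambda>\<xi>. g \<xi> * exp (\<i> * of_real x * of_real \<xi>))"
    using continuous_on_subset[OF g(1)]
    by (intro borel_integrable_atLeastAtMost' continuous_intros) auto
  from set_borel_integral_eq_integral(2)[OF this]
  have "pw_extension r g (of_real x) =
      (LINT \<xi>|lborel. indicator {-r..r} \<xi> *\<^sub>R (g \<xi> * exp (\<i> * of_real x * of_real \<xi>)))"
    by (simp add: pw_extension_def set_lebesgue_integral_def)
  also have "\<dots> = (LINT \<xi>|lborel. g \<xi> * exp (\<i> * of_real x * of_real \<xi>))"
    by (intro Bochner_Integration.integral_cong refl) (use g(2) in \<open>auto simp: indicator_def\<close>)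
  finally show ?thesis
    by (simp add: fourier_adj_def)
qed

text \<open>Here 1 + t is at most 2 max(1, t). This turns bounds on f and z^n f into decay of order
  n in 1 + |z|.\<close>

lemma one_plus_power_le:
  fixes t :: real
  assumes "t \<ge> 0"
  shows "(1 + t) ^ n \<le> 2 ^ n * (1 + t ^ n)"
proof -
  have "(1 + t) ^ n \<le> (2 * max 1 t) ^ n"
    using assms by (intro power_mono) auto
  also have "\<dots> = 2 ^ n * (max 1 t) ^ n"
    by (rule power_mult_distrib)
  also have "\<dots> \<le> 2 ^ n * (1 + t ^ n)"
    using assms by (intro mult_left_mono) (auto simp: max_def)
  finally show ?thesis .
qed

text \<open>Differentiating the extension n times multiplies g by (i \<xi>)^n, which keeps it smooth
  with the same support bound. One family of estimates therefore yields both the Schwartz bounds, on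
  the real axis where exp(r |Im z|) = 1, and the decay of the extension.\<close>

theorem fourier_adj_test_functions:
  assumes "g \<in> test_functions"
  shows "fourier_adj g \<in> Z_space"
proof -
  obtain r0 where r0: "r0 > 0" "\<And>x. r0 < \<bar>x\<bar> \<Longrightarrow> g x = 0"
    using test_functions_supp_bounded[OF assms] by blast
  define r where "r = r0 + 1"
  have r: "r > 0" "r0 < r"
    using r0(1) by (auto simp: r_def)
  have g: "smooth g"
    using assms by (simp add: test_functions_def)
  then have cont: "continuous_on UNIV g"
    by (rule smooth_continuous_on)
  define c where "c = complex_of_real ((2 * pi) powr (-1/2))"
  define f where "f = (\<lambda>z. c * pw_extension r g z)"
  have f: "f holomorphic_on UNIV"
    unfolding f_def by (intro holomorphic_intros pw_extension_holomorphic cont)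
  have eq: "fourier_adj g = (\<lambda>x. f (of_real x))"
    unfolding f_def c_def using r r0 by (intro ext fourier_adj_eq_pw_extension cont) auto
  have bound: "\<exists>C. \<forall>z. norm (z ^ k * (deriv ^^ n) f z) \<le> C * exp (r * \<bar>Im z\<bar>)" for k n
  proof -
    have "smooth (\<lambda>\<xi>. (\<lambda>z. (\<i> * z) ^ n) (of_real \<xi>) * g \<xi>)"
      by (intro smooth_mult g smooth_of_real holomorphic_intros)
    then obtain C where "\<And>z. norm (z ^ k * pw_extension r (\<lambda>\<xi>. (\<i> * of_real \<xi>) ^ n * g \<xi>) z) \<le> C * exp (r * \<bar>Im z\<bar>)"
      using pw_extension_power_bound[of "\<lambda>\<xi>. (\<i> * of_real \<xi>) ^ n * g \<xi>" r0 r k] r0 r by auto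
    then have "norm c * norm (z ^ k * pw_extension r (\<lambda>\<xi>. (\<i> * of_real \<xi>) ^ n * g \<xi>) z) \<le>
        norm c * (C * exp (r * \<bar>Im z\<bar>))" for z
      by (intro mult_left_mono) auto
    then show ?thesis
      unfolding f_def pw_extension_higher_deriv[OF cont]
      by (intro exI[of _ "norm c * C"]) (auto simp: norm_mult mult_ac)
  qed
  have "\<exists>C. \<forall>x. norm (of_real x ^ k * (vderiv ^^ n) (fourier_adj g) x) \<le> C" for k n
  proof -
    obtain C where "\<And>z. norm (z ^ k * (deriv ^^ n) f z) \<le> C * exp (r * \<bar>Im z\<bar>)"
      using bound by blast
    from this[of "of_real _"] show ?thesis
      unfolding eq vderiv_funpow_of_real[OF f] by auto
  qed
  moreover have "smooth (fourier_adj g)"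
    unfolding eq by (rule smooth_of_real[OF f])
  moreover have "\<exists>C. \<forall>z. norm (f z) \<le> C * inverse ((1 + norm z) ^ n) * exp (r * \<bar>Im z\<bar>)" for n
  proof -
    \<comment> \<open>The powers 0 and n are the two terms on the right of
      \<open>one_plus_power_le\<close>.\<close>
    obtain C0 Cn where C: "\<And>z. norm (f z) \<le> C0 * exp (r * \<bar>Im z\<bar>)"
      "\<And>z. norm (z ^ n * f z) \<le> Cn * exp (r * \<bar>Im z\<bar>)"
      using bound[of 0 0] bound[of n 0] by auto
    have "norm (f z) \<le> 2 ^ n * (C0 + Cn) * inverse ((1 + norm z) ^ n) * exp (r * \<bar>Im z\<bar>)" for z
    proof -
      have "(1 + norm z) ^ n * norm (f z) \<le> 2 ^ n * (1 + norm z ^ n) * norm (f z)"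
        by (intro mult_right_mono one_plus_power_le) auto
      also have "\<dots> = 2 ^ n * (norm (f z) + norm (z ^ n * f z))"
        by (simp add: algebra_simps norm_mult norm_power)
      also have "\<dots> \<le> 2 ^ n * (C0 * exp (r * \<bar>Im z\<bar>) + Cn * exp (r * \<bar>Im z\<bar>))"
        by (intro mult_left_mono add_mono C) auto
      finally show ?thesis
        by (simp add: field_simps add_pos_nonneg)
    qed
    then show ?thesis by blast
  qed
  ultimately show ?thesis
    using f r(1) eq by (auto simp: Z_space_def schwartz_def intro!: exI[of _ f])
qed

section \<open>Smoothness of the Fourier transform\<close>

text \<open>Decay is asked of the function alone and not of its derivatives: this makes the class
  closed under multiplication by x, which is what differentiating the transform requires.\<close>

definition rapidly_decreasing :: "(real \<Rightarrow> complex) \<Rightarrow> bool" where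
  "rapidly_decreasing \<phi> \<longleftrightarrow> continuous_on UNIV \<phi> \<and>
     (\<forall>n. \<exists>C. \<forall>x. norm (\<phi> x) \<le> C * inverse ((1 + \<bar>x\<bar>) ^ n))"

lemma integrable_inverse_1_plus_sq: "integrable lborel (\<lambda>x::real. inverse (1 + x\<^sup>2))"
  using integrable_inverse_1_plus_square by (simp add: set_integrable_def einterval_eq)

text \<open>Here y stands for |x| on the real axis and for the modulus of a point with real part x
  on a shifted line.\<close>

lemma inverse_one_plus_le:
  fixes x y :: real
  assumes "\<bar>x\<bar> \<le> y"
  shows "inverse ((1 + y) ^ 2) \<le> inverse (1 + x\<^sup>2)"
proof (rule le_imp_inverse_le)
  have "x\<^sup>2 \<le> y\<^sup>2"
    using assms by (metis abs_le_square_iff abs_ge_self order_trans)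
  then show "1 + x\<^sup>2 \<le> (1 + y)\<^sup>2"
    using assms by (simp add: power2_eq_square algebra_simps)
qed (simp add: add_pos_nonneg)

lemma integrable_of_inverse_bound:
  fixes \<phi> :: "real \<Rightarrow> complex"
  assumes "continuous_on UNIV \<phi>" "\<And>x. norm (\<phi> x) \<le> C * inverse (1 + x\<^sup>2)"
  shows "integrable lborel \<phi>"
proof (rule Bochner_Integration.integrable_bound)
  show "integrable lborel (\<lambda>x::real. C * inverse (1 + x\<^sup>2))"
    by (intro integrable_mult_right integrable_inverse_1_plus_sq)
  show "\<phi> \<in> borel_measurable lborel"
    using borel_measurable_continuous_onI[OF assms(1)] by simp
  show "AE x in lborel. norm (\<phi> x) \<le> norm (C * inverse (1 + x\<^sup>2))"
    using order_trans[OF assms(2) abs_ge_self] by auto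
qed

lemma rapidly_decreasing_integrable:
  assumes "rapidly_decreasing \<phi>"
  shows "integrable lborel \<phi>"
proof -
  obtain C where C: "\<And>x. norm (\<phi> x) \<le> C * inverse ((1 + \<bar>x\<bar>) ^ 2)"
    using assms by (auto simp: rapidly_decreasing_def)
  have "norm (\<phi> x) \<le> \<bar>C\<bar> * inverse (1 + x\<^sup>2)" for x
  proof -
    have "norm (\<phi> x) \<le> \<bar>C\<bar> * inverse ((1 + \<bar>x\<bar>) ^ 2)"
      by (intro order_trans[OF C] mult_right_mono) auto
    also have "\<dots> \<le> \<bar>C\<bar> * inverse (1 + x\<^sup>2)"
      by (intro mult_left_mono inverse_one_plus_le) auto
    finally show ?thesis .
  qed
  then show ?thesis
    using assms by (intro integrable_of_inverse_bound) (auto simp: rapidly_decreasing_def)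
qed

lemma rapidly_decreasing_times_x:
  assumes "rapidly_decreasing \<phi>"
  shows "rapidly_decreasing (\<lambda>x. c * of_real x * \<phi> x)"
  unfolding rapidly_decreasing_def
proof (intro conjI allI)
  show "continuous_on UNIV (\<lambda>x. c * of_real x * \<phi> x)"
    using assms by (intro continuous_intros) (auto simp: rapidly_decreasing_def)
  fix n
  obtain C where C: "\<And>x. norm (\<phi> x) \<le> C * inverse ((1 + \<bar>x\<bar>) ^ Suc n)"
    using assms unfolding rapidly_decreasing_def by blast
  have "norm (c * of_real x * \<phi> x) \<le> norm c * \<bar>C\<bar> * inverse ((1 + \<bar>x\<bar>) ^ n)" for x
  proof -
    have "\<bar>x\<bar> * norm (\<phi> x) \<le> (1 + \<bar>x\<bar>) * (\<bar>C\<bar> * inverse ((1 + \<bar>x\<bar>) ^ Suc n))"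
      by (intro mult_mono order_trans[OF C] mult_right_mono) auto
    also have "\<dots> = \<bar>C\<bar> * inverse ((1 + \<bar>x\<bar>) ^ n)"
    proof -
      have "a * (c * inverse (a ^ Suc n)) = c * inverse (a ^ n)" if "a \<noteq> 0" for a c :: real
        using that by (simp add: field_simps)
      then show ?thesis
        by simp
    qed
    finally have "norm c * (\<bar>x\<bar> * norm (\<phi> x)) \<le> norm c * (\<bar>C\<bar> * inverse ((1 + \<bar>x\<bar>) ^ n))"
      by (rule mult_left_mono) auto
    then show ?thesis
      by (simp add: norm_mult mult_ac)
  qed
  then show "\<exists>C. \<forall>x. norm (c * of_real x * \<phi> x) \<le> C * inverse ((1 + \<bar>x\<bar>) ^ n)"
    by blast
qed

lemma integrable_mult_exp_i:
  fixes \<phi> :: "real \<Rightarrow> complex"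
  assumes "integrable lborel \<phi>"
  shows "integrable lborel (\<lambda>x. \<phi> x * exp (- \<i> * of_real x * of_real \<xi>))"
proof -
  have [measurable]: "\<phi> \<in> borel_measurable borel"
    using assms by auto
  show ?thesis
    by (rule Bochner_Integration.integrable_bound[OF assms]) (auto simp: norm_mult)
qed

lemma iexp_taylor1: "norm (exp (- \<i> * of_real x * of_real h) - 1 + \<i> * of_real x * of_real h) \<le> (x * h)\<^sup>2 / 2"
  using iexp_approx1[of "- x * h" 1] by (simp add: eval_nat_numeral algebra_simps abs_mult flip: power_mult_distrib)

text \<open>The second-order Taylor bound for exp(- i x h) is integrated against |\<phi> x|, so the
  remainder is at most a second moment of \<phi> times h^2. No limit is taken under the
  integral.\<close>

lemma fourier_has_vector_derivative:
  assumes "rapidly_decreasing \<phi>"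
  shows "(fourier \<phi> has_vector_derivative fourier (\<lambda>x. - \<i> * of_real x * \<phi> x) \<xi>) (at \<xi>)"
proof -
  define c where "c = complex_of_real ((2 * pi) powr (-1/2))"
  define E where "E = (\<lambda>x \<xi>. exp (- \<i> * complex_of_real x * complex_of_real \<xi>))"
  have i0: "integrable lborel \<phi>"
    by (rule rapidly_decreasing_integrable[OF assms])
  have r1: "rapidly_decreasing (\<lambda>x. - \<i> * of_real x * \<phi> x)"
    by (rule rapidly_decreasing_times_x[OF assms])
  have r2: "rapidly_decreasing (\<lambda>x. 1 * of_real x * (- \<i> * of_real x * \<phi> x))"
    by (rule rapidly_decreasing_times_x[OF r1])
  note i1 = rapidly_decreasing_integrable[OF r1]
  have "norm (1 * of_real x * (- \<i> * of_real x * \<phi> x)) = norm (\<phi> x) * x\<^sup>2" for x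
    by (simp add: norm_mult power2_eq_square flip: mult.assoc)
  then have i2: "integrable lborel (\<lambda>x. norm (\<phi> x) * x\<^sup>2)"
    using integrable_norm[OF rapidly_decreasing_integrable[OF r2]] by (simp only:)
  define M where "M = (LINT x|lborel. norm (\<phi> x) * x\<^sup>2)"
  have est: "norm (fourier \<phi> y - fourier \<phi> \<xi> - (y - \<xi>) *\<^sub>R fourier (\<lambda>x. - \<i> * of_real x * \<phi> x) \<xi>)
      \<le> norm c * (M * (y - \<xi>)\<^sup>2)" for y
  proof -
    define h where "h = y - \<xi>"
    have "fourier \<phi> y - fourier \<phi> \<xi> - h *\<^sub>R fourier (\<lambda>x. - \<i> * of_real x * \<phi> x) \<xi> =
        c * (LINT x|lborel. \<phi> x * E x y - \<phi> x * E x \<xi> - of_real h * (- \<i> * of_real x * \<phi> x * E x \<xi>))"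
    proof -
      have "(LINT x|lborel. \<phi> x * E x y - \<phi> x * E x \<xi> - of_real h * (- \<i> * of_real x * \<phi> x * E x \<xi>)) =
        (LINT x|lborel. \<phi> x * E x y) - (LINT x|lborel. \<phi> x * E x \<xi>) -
        of_real h * (LINT x|lborel. - \<i> * of_real x * \<phi> x * E x \<xi>)"
        unfolding E_def integral_mult_right_zero[symmetric]
        by (intro Bochner_Integration.integral_diff[THEN trans] arg_cong2[where f = "(-)"] refl
            Bochner_Integration.integrable_diff integrable_mult_right integrable_mult_exp_i i0 i1)
      moreover have "fourier \<psi> = (\<lambda>\<xi>. c * (LINT x|lborel. \<psi> x * E x \<xi>))" for \<psi>
        by (simp add: fourier_def c_def E_def)
      moreover have "c * Y - c * X - h *\<^sub>R (c * D) = c * (Y - X - of_real h * D)" for X Y D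
        by (simp add: scaleR_conv_of_real algebra_simps)
      ultimately show ?thesis
        by (simp only:)
    qed
    moreover have "norm (LINT x|lborel. \<phi> x * E x y - \<phi> x * E x \<xi> - of_real h * (- \<i> * of_real x * \<phi> x * E x \<xi>))
        \<le> (LINT x|lborel. (norm (\<phi> x) * x\<^sup>2) * h\<^sup>2)"
    proof (rule Bochner_Integration.integral_norm_bound_integral)
      show "integrable lborel (\<lambda>x. \<phi> x * E x y - \<phi> x * E x \<xi> - of_real h * (- \<i> * of_real x * \<phi> x * E x \<xi>))"
        unfolding E_def
        by (intro Bochner_Integration.integrable_diff integrable_mult_right integrable_mult_exp_i i0 i1)
      show "integrable lborel (\<lambda>x. norm (\<phi> x) * x\<^sup>2 * h\<^sup>2)"
        by (intro integrable_mult_left i2)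
      fix x :: real
      have "E x y = E x \<xi> * exp (- \<i> * of_real x * of_real h)"
        by (simp add: E_def h_def algebra_simps flip: exp_add)
      then have "\<phi> x * E x y - \<phi> x * E x \<xi> - of_real h * (- \<i> * of_real x * \<phi> x * E x \<xi>) =
          \<phi> x * E x \<xi> * (exp (- \<i> * of_real x * of_real h) - 1 + \<i> * of_real x * of_real h)"
        by (simp add: algebra_simps)
      then have "norm (\<phi> x * E x y - \<phi> x * E x \<xi> - of_real h * (- \<i> * of_real x * \<phi> x * E x \<xi>)) =
          norm (\<phi> x) * norm (exp (- \<i> * of_real x * of_real h) - 1 + \<i> * of_real x * of_real h)"
        by (simp only: norm_mult) (simp add: E_def)
      also have "\<dots> \<le> norm (\<phi> x) * ((x * h)\<^sup>2 / 2)"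
        by (intro mult_left_mono iexp_taylor1) auto
      also have "\<dots> \<le> norm (\<phi> x) * (x * h)\<^sup>2"
        by (intro mult_left_mono) auto
      finally show "norm (\<phi> x * E x y - \<phi> x * E x \<xi> - of_real h * (- \<i> * of_real x * \<phi> x * E x \<xi>)) \<le>
          norm (\<phi> x) * x\<^sup>2 * h\<^sup>2"
        by (simp add: power_mult_distrib mult_ac)
    qed
    ultimately show ?thesis
      by (simp add: M_def norm_mult mult_left_mono flip: h_def)
  qed
  show ?thesis
    unfolding has_vector_derivative_def
  proof (rule has_derivativeI_sandwich[where e = 1 and H = "\<lambda>y. norm c * (M * \<bar>y - \<xi>\<bar>)"])
    show "bounded_linear (\<lambda>y. y *\<^sub>R fourier (\<lambda>x. - \<i> * of_real x * \<phi> x) \<xi>)"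
      by (rule bounded_linear_scaleR_left)
    show "((\<lambda>y. norm c * (M * \<bar>y - \<xi>\<bar>)) \<longlongrightarrow> 0) (at \<xi>)"
      by (auto intro!: tendsto_eq_intros)
    fix y :: real
    assume "y \<noteq> \<xi>"
    then show "norm (fourier \<phi> y - fourier \<phi> \<xi> - (y - \<xi>) *\<^sub>R fourier (\<lambda>x. - \<i> * of_real x * \<phi> x) \<xi>) / norm (y - \<xi>)
        \<le> norm c * (M * \<bar>y - \<xi>\<bar>)"
      using est[of y] by (subst pos_divide_le_eq) (simp_all add: power2_eq_square mult.assoc)
  qed simp
qed

lemma smooth_fourier:
  assumes "rapidly_decreasing \<phi>"
  shows "smooth (fourier \<phi>)"
proof (rule smooth_coinduct[where P = "\<lambda>w. \<exists>\<phi>. rapidly_decreasing \<phi> \<and> w = fourier \<phi>"])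
  fix w
  assume "\<exists>\<phi>. rapidly_decreasing \<phi> \<and> w = fourier \<phi>"
  then obtain \<psi> where \<psi>: "rapidly_decreasing \<psi>" "w = fourier \<psi>" by blast
  note D = fourier_has_vector_derivative[OF \<psi>(1)]
  have "vderiv w = fourier (\<lambda>x. - \<i> * of_real x * \<psi> x)"
    unfolding \<psi>(2) by (rule vderiv_eqI[OF D])
  moreover have "w differentiable (at x)" for x
    unfolding \<psi>(2) using D by (rule differentiableI_vector)
  ultimately show "(\<forall>x. w differentiable (at x)) \<and> (\<exists>\<phi>. rapidly_decreasing \<phi> \<and> vderiv w = fourier \<phi>)"
    using rapidly_decreasing_times_x[OF \<psi>(1), of "- \<i>"] by blast
qed (use assms in blast)

section \<open>Shifting the line of integration, and the support of the Fourier transform\<close>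

text \<open>An entire function has a primitive P, so integrals over truncated lines are differences
  of P at the corners of a rectangle. What separates the two lines are the vertical sides, of size A
  |\<eta>| / (1 + n^2); this is why the bound is required on the whole strip.\<close>

lemma contour_shift:
  assumes G: "G holomorphic_on UNIV"
    and bound: "\<And>x \<theta>. \<bar>\<theta>\<bar> \<le> \<bar>\<eta>\<bar> \<Longrightarrow> norm (G (Complex x \<theta>)) \<le> A * inverse (1 + x\<^sup>2)"
  shows "(LINT x|lborel. G (Complex x \<eta>)) = (LINT x|lborel. G (of_real x))"
proof -
  obtain P where P: "\<And>z. (P has_field_derivative G z) (at z)"
    using holomorphic_convex_primitive'[OF convex_UNIV open_UNIV G] by auto
  have G': "continuous_on S (\<lambda>x. G (h x))" if "continuous_on S h" for S :: "real set" and h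
    using that holomorphic_on_imp_continuous_on[OF G] continuous_on_compose2 by blast
  have C: "continuous_on S (\<lambda>x. Complex x \<theta>)" for S \<theta>
    unfolding Complex_eq by (intro continuous_intros)
  have line: "integrable lborel (\<lambda>x. G (Complex x \<theta>))"
    "(LINT x|lborel. indicator {- real n..real n} x *\<^sub>R G (Complex x \<theta>)) = P (Complex (real n) \<theta>) - P (Complex (- real n) \<theta>)"
    "(\<lambda>n. LINT x|lborel. indicator {- real n..real n} x *\<^sub>R G (Complex x \<theta>)) \<longlonglongrightarrow> (LINT x|lborel. G (Complex x \<theta>))"
    if \<theta>: "\<bar>\<theta>\<bar> \<le> \<bar>\<eta>\<bar>" for \<theta> n
  proof -
    show *: "integrable lborel (\<lambda>x. G (Complex x \<theta>))"
      using bound[OF \<theta>] by (intro integrable_of_inverse_bound G' C) auto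
    show "(LINT x|lborel. indicator {- real n..real n} x *\<^sub>R G (Complex x \<theta>)) = P (Complex (real n) \<theta>) - P (Complex (- real n) \<theta>)"
    proof (rule integral_FTC_atLeastAtMost)
      show "continuous_on {- real n..real n} (\<lambda>x. G (Complex x \<theta>))"
        by (intro G' C)
      fix x :: real
      have "((\<lambda>z. P (z + \<i> * of_real \<theta>)) has_field_derivative G (Complex x \<theta>)) (at (of_real x))"
        unfolding Complex_eq by (rule iffD1[OF DERIV_shift P])
      from has_vector_derivative_real_field[OF this]
      show "((\<lambda>x. P (Complex x \<theta>)) has_vector_derivative G (Complex x \<theta>)) (at x within {- real n..real n})"
        by (simp add: Complex_eq)
    qed simp
    have [measurable]: "(\<lambda>x. G (Complex x \<theta>)) \<in> borel_measurable borel"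
      using * by auto
    show "(\<lambda>n. LINT x|lborel. indicator {- real n..real n} x *\<^sub>R G (Complex x \<theta>)) \<longlonglongrightarrow> (LINT x|lborel. G (Complex x \<theta>))"
    proof (rule integral_dominated_convergence[where w = "\<lambda>x. norm (G (Complex x \<theta>))"])
      show "AE x in lborel. (\<lambda>n. indicator {- real n..real n} x *\<^sub>R G (Complex x \<theta>)) \<longlonglongrightarrow> G (Complex x \<theta>)"
      proof (intro AE_I2 tendsto_eventually)
        fix x :: real
        obtain N where "\<bar>x\<bar> \<le> real N"
          using real_arch_simple by blast
        then show "\<forall>\<^sub>F n in sequentially. indicator {- real n..real n} x *\<^sub>R G (Complex x \<theta>) = G (Complex x \<theta>)"
          by (intro eventually_sequentiallyI[of N]) (auto simp: indicator_def)
      qed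
    qed (use * in \<open>auto simp: indicator_def\<close>)
  qed
  have vert: "norm (P (Complex x \<eta>) - P (Complex x 0)) \<le> A * inverse (1 + x\<^sup>2) * \<bar>\<eta>\<bar>" for x
  proof -
    have "norm (P (Complex x \<eta>) - P (Complex x 0)) \<le> A * inverse (1 + x\<^sup>2) * norm (Complex x \<eta> - Complex x 0)"
    proof (rule field_differentiable_bound[where S = "closed_segment (Complex x 0) (Complex x \<eta>)"])
      fix z
      assume z: "z \<in> closed_segment (Complex x 0) (Complex x \<eta>)"
      show "(P has_field_derivative G z) (at z within closed_segment (Complex x 0) (Complex x \<eta>))"
        using P has_field_derivative_at_within by blast
      obtain u where u: "0 \<le> u" "u \<le> 1" "z = Complex x (u * \<eta>)"
        using z by (auto simp: in_segment complex_eq_iff algebra_simps)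
      have "\<bar>u * \<eta>\<bar> \<le> \<bar>\<eta>\<bar>"
        using u by (simp add: abs_mult mult_left_le_one_le)
      with u bound show "norm (G z) \<le> A * inverse (1 + x\<^sup>2)"
        by simp
    qed auto
    also have "norm (Complex x \<eta> - Complex x 0) = \<bar>\<eta>\<bar>"
      by (simp add: complex_norm complex_diff)
    finally show ?thesis .
  qed
  have "(\<lambda>n. (P (Complex (real n) \<eta>) - P (Complex (- real n) \<eta>)) - (P (Complex (real n) 0) - P (Complex (- real n) 0)))
      \<longlonglongrightarrow> (LINT x|lborel. G (Complex x \<eta>)) - (LINT x|lborel. G (Complex x 0))"
    using tendsto_diff[OF line(3)[of \<eta>] line(3)[of 0]] by (simp add: line(2))
  moreover have "(\<lambda>n. (P (Complex (real n) \<eta>) - P (Complex (- real n) \<eta>)) - (P (Complex (real n) 0) - P (Complex (- real n) 0))) \<longlonglongrightarrow> 0"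
  proof (rule Lim_null_comparison)
    show "\<forall>\<^sub>F n in sequentially. norm ((P (Complex (real n) \<eta>) - P (Complex (- real n) \<eta>)) - (P (Complex (real n) 0) - P (Complex (- real n) 0)))
        \<le> 2 * (A * inverse (1 + (real n)\<^sup>2) * \<bar>\<eta>\<bar>)"
    proof (intro always_eventually allI)
      fix n
      \<comment> \<open>Regrouping the four corner values turns horizontal differences into vertical
        ones.\<close>
      have "(P (Complex (real n) \<eta>) - P (Complex (- real n) \<eta>)) - (P (Complex (real n) 0) - P (Complex (- real n) 0)) =
         (P (Complex (real n) \<eta>) - P (Complex (real n) 0)) - (P (Complex (- real n) \<eta>) - P (Complex (- real n) 0))"
        by simp
      also have "norm \<dots> \<le> A * inverse (1 + (real n)\<^sup>2) * \<bar>\<eta>\<bar> + A * inverse (1 + (- real n)\<^sup>2) * \<bar>\<eta>\<bar>"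
        by (rule order_trans[OF norm_triangle_ineq4 add_mono[OF vert vert]])
      finally show "norm ((P (Complex (real n) \<eta>) - P (Complex (- real n) \<eta>)) - (P (Complex (real n) 0) - P (Complex (- real n) 0)))
        \<le> 2 * (A * inverse (1 + (real n)\<^sup>2) * \<bar>\<eta>\<bar>)"
        by (simp only: power2_minus mult_2)
    qed
    show "(\<lambda>n. 2 * (A * inverse (1 + (real n)\<^sup>2) * \<bar>\<eta>\<bar>)) \<longlonglongrightarrow> 0"
      by real_asymp
  qed
  ultimately have "(LINT x|lborel. G (Complex x \<eta>)) - (LINT x|lborel. G (Complex x 0)) = 0"
    by (rule LIMSEQ_unique)
  then show ?thesis
    by (simp add: complex_of_real_def)
qed

lemma Z_space_extension:
  assumes "\<phi> \<in> Z_space"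
  obtains f r where "f holomorphic_on UNIV" "\<And>x. f (of_real x) = \<phi> x" "r > 0"
    "\<And>n::nat. \<exists>C. \<forall>z. norm (f z) \<le> C * inverse ((1 + norm z) ^ n) * exp (r * \<bar>Im z\<bar>)"
  using assms unfolding Z_space_def by blast

lemma Z_space_rapidly_decreasing:
  assumes "\<phi> \<in> Z_space"
  shows "rapidly_decreasing \<phi>"
proof -
  obtain f r where f: "f holomorphic_on UNIV" "\<And>x. f (of_real x) = \<phi> x"
    "\<And>n::nat. \<exists>C. \<forall>z. norm (f z) \<le> C * inverse ((1 + norm z) ^ n) * exp (r * \<bar>Im z\<bar>)"
    using Z_space_extension[OF assms] by metis
  have "\<exists>C. \<forall>x. norm (\<phi> x) \<le> C * inverse ((1 + \<bar>x\<bar>) ^ n)" for n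
  proof -
    obtain C where C: "\<And>z. norm (f z) \<le> C * inverse ((1 + norm z) ^ n) * exp (r * \<bar>Im z\<bar>)"
      using f(3) by blast
    show ?thesis
      using C[of "of_real _"] by (auto simp: f(2))
  qed
  moreover have "smooth \<phi>"
    using assms by (simp add: Z_space_def schwartz_def)
  ultimately show ?thesis
    by (simp add: rapidly_decreasing_def smooth_continuous_on)
qed

text \<open>Used twice: to get the left end of the support of a transform from the right end, and to
  handle F (exp (- x)).\<close>

lemma Z_space_reflect:
  assumes "\<phi> \<in> Z_space"
  shows "(\<lambda>x. \<phi> (- x)) \<in> Z_space"
proof -
  obtain f r where f: "f holomorphic_on UNIV" "\<And>x. f (of_real x) = \<phi> x" "r > 0"
    "\<And>n::nat. \<exists>C. \<forall>z. norm (f z) \<le> C * inverse ((1 + norm z) ^ n) * exp (r * \<bar>Im z\<bar>)"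
    using Z_space_extension[OF assms] by metis
  have sm: "smooth \<phi>" and sch: "\<And>k n. \<exists>C. \<forall>x. norm (of_real x ^ k * (vderiv ^^ n) \<phi> x) \<le> C"
    using assms by (auto simp: Z_space_def schwartz_def)
  have "\<exists>C. \<forall>x. norm (of_real x ^ k * (vderiv ^^ n) (\<lambda>x. \<phi> (- x)) x) \<le> C" for k n
  proof -
    obtain C where "\<And>x. norm (of_real x ^ k * (vderiv ^^ n) \<phi> x) \<le> C"
      using sch by blast
    from this[of "- _"] show ?thesis
      by (auto simp: vderiv_funpow_reflect[OF sm] norm_mult norm_power)
  qed
  then have "(\<lambda>x. \<phi> (- x)) \<in> schwartz"
    by (simp add: schwartz_def smooth_reflect[OF sm])
  moreover have "(\<lambda>z. f (- z)) holomorphic_on UNIV"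
    using holomorphic_on_compose_gen[of uminus UNIV f UNIV] f(1) by (simp add: o_def holomorphic_intros)
  moreover have "f (- of_real x) = \<phi> (- x)" for x
    using f(2)[of "- x"] by simp
  moreover have "\<exists>C. \<forall>z. norm (f (- z)) \<le> C * inverse ((1 + norm z) ^ n) * exp (r * \<bar>Im z\<bar>)" for n :: nat
  proof -
    obtain C where C: "\<And>z. norm (f z) \<le> C * inverse ((1 + norm z) ^ n) * exp (r * \<bar>Im z\<bar>)"
      using f(4) by blast
    show ?thesis
      using C[of "- _"] by auto
  qed
  ultimately show ?thesis
    using f(3) unfolding Z_space_def by (auto intro!: exI[of _ "\<lambda>z. f (- z)"])
qed

text \<open>Moving the line of integration to \<open>Im z = - t\<close> with \<open>t\<close> large makes the integral
  arbitrarily small.\<close>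
lemma fourier_eq_0_right:
  assumes f: "f holomorphic_on UNIV" "\<And>x. f (of_real x) = \<phi> x"
    and C: "\<And>z. norm (f z) \<le> C * inverse ((1 + norm z) ^ 2) * exp (r * \<bar>Im z\<bar>)"
    and "r < \<xi>" "0 < r"
  shows "fourier \<phi> \<xi> = 0"
proof -
  define G where "G = (\<lambda>z. f z * exp (- \<i> * z * of_real \<xi>))"
  define I where "I = (LINT x|lborel. G (of_real x))"
  define M where "M = (LINT x|lborel. inverse (1 + x\<^sup>2 :: real))"
  have "0 \<le> norm (f 0)"
    by simp
  also have "\<dots> \<le> C"
    using C[of 0] by simp
  finally have "C \<ge> 0" .
  have G: "G holomorphic_on UNIV"
    unfolding G_def by (intro holomorphic_intros f)
  have Gb: "norm (G (Complex x \<theta>)) \<le> C * inverse (1 + x\<^sup>2) * exp (r * \<bar>\<theta>\<bar> + \<xi> * \<theta>)" for x \<theta>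
  proof -
    have "norm (f (Complex x \<theta>)) \<le> C * inverse ((1 + norm (Complex x \<theta>)) ^ 2) * exp (r * \<bar>\<theta>\<bar>)"
      using C[of "Complex x \<theta>"] by simp
    also have "\<dots> \<le> C * inverse (1 + x\<^sup>2) * exp (r * \<bar>\<theta>\<bar>)"
      using \<open>C \<ge> 0\<close> abs_Re_le_cmod[of "Complex x \<theta>"]
      by (intro mult_right_mono mult_left_mono inverse_one_plus_le) auto
    finally have "norm (f (Complex x \<theta>)) * exp (\<xi> * \<theta>) \<le> C * inverse (1 + x\<^sup>2) * exp (r * \<bar>\<theta>\<bar>) * exp (\<xi> * \<theta>)"
      by (intro mult_right_mono) auto
    then show ?thesis
      by (simp add: G_def norm_mult exp_add mult_ac)
  qed
  have bound: "norm I \<le> C * M * exp (- ((\<xi> - r) * t))" if "t \<ge> 0" for t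
  proof -
    have "I = (LINT x|lborel. G (Complex x (- t)))"
      unfolding I_def
    proof (rule contour_shift[OF G, symmetric])
      fix x \<theta>
      assume \<theta>: "\<bar>\<theta>\<bar> \<le> \<bar>- t\<bar>"
      \<comment> \<open>Inside the strip a bound growing with t suffices, as it only has to remove
        the vertical sides. The decay in t is read off on the final line.\<close>
      have "r * \<bar>\<theta>\<bar> + \<xi> * \<theta> \<le> r * t + \<xi> * t"
        using \<theta> that assms by (intro add_mono mult_left_mono) auto
      then have "C * inverse (1 + x\<^sup>2) * exp (r * \<bar>\<theta>\<bar> + \<xi> * \<theta>) \<le> C * inverse (1 + x\<^sup>2) * exp (r * t + \<xi> * t)"
        using \<open>C \<ge> 0\<close> by (intro mult_left_mono) auto
      from order_trans[OF Gb this]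
      show "norm (G (Complex x \<theta>)) \<le> (C * exp (r * t + \<xi> * t)) * inverse (1 + x\<^sup>2)"
        by (simp add: mult_ac)
    qed
    moreover have b: "norm (G (Complex x (- t))) \<le> (C * exp (- ((\<xi> - r) * t))) * inverse (1 + x\<^sup>2)" for x
      using Gb[of x "- t"] that by (simp add: algebra_simps)
    have "norm (LINT x|lborel. G (Complex x (- t))) \<le> (LINT x|lborel. (C * exp (- ((\<xi> - r) * t))) * inverse (1 + x\<^sup>2))"
    proof (rule Bochner_Integration.integral_norm_bound_integral)
      have "continuous_on UNIV (\<lambda>x. Complex x (- t))"
        unfolding Complex_eq by (intro continuous_intros)
      with holomorphic_on_imp_continuous_on[OF G] have "continuous_on UNIV (\<lambda>x. G (Complex x (- t)))"
        using continuous_on_compose2 by blast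
      then show "integrable lborel (\<lambda>x. G (Complex x (- t)))"
        using b by (rule integrable_of_inverse_bound)
    qed (use b integrable_inverse_1_plus_sq in auto)
    ultimately show ?thesis
      by (simp add: M_def mult_ac)
  qed
  have "((\<lambda>t. C * M * exp (- ((\<xi> - r) * t))) \<longlongrightarrow> 0) at_top"
    using \<open>r < \<xi>\<close> by real_asymp
  moreover have "\<forall>\<^sub>F t in at_top. norm I \<le> C * M * exp (- ((\<xi> - r) * t))"
    using eventually_ge_at_top[of 0] by eventually_elim (rule bound)
  ultimately have "norm I \<le> 0"
    by (intro tendsto_lowerbound) auto
  then show ?thesis
    by (simp add: fourier_def I_def G_def f(2))
qed

text \<open>The contour is shifted for large positive frequencies only; the negative ones follow
  from the reflected function.\<close>

theorem fourier_Z_space: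
  assumes "\<phi> \<in> Z_space"
  shows "fourier \<phi> \<in> test_functions"
proof -
  have right: "\<exists>r. \<forall>\<xi>>r. fourier \<phi> \<xi> = 0" if "\<phi> \<in> Z_space" for \<phi>
  proof -
    obtain f r where f: "f holomorphic_on UNIV" "\<And>x. f (of_real x) = \<phi> x" "r > 0"
      "\<And>n::nat. \<exists>C. \<forall>z. norm (f z) \<le> C * inverse ((1 + norm z) ^ n) * exp (r * \<bar>Im z\<bar>)"
      using Z_space_extension[OF \<open>\<phi> \<in> Z_space\<close>] by metis
    from f(4)[of 2] obtain C where "\<And>z. norm (f z) \<le> C * inverse ((1 + norm z) ^ 2) * exp (r * \<bar>Im z\<bar>)"
      by blast
    with fourier_eq_0_right[OF f(1,2)] f(3) show ?thesis
      by blast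
  qed
  obtain r1 r2 where "\<And>\<xi>. \<xi> > r1 \<Longrightarrow> fourier \<phi> \<xi> = 0" "\<And>\<xi>. \<xi> > r2 \<Longrightarrow> fourier (\<lambda>x. \<phi> (- x)) \<xi> = 0"
    using right[OF assms] right[OF Z_space_reflect[OF assms]] by blast
  then have r: "\<And>\<xi>. \<xi> > r1 \<Longrightarrow> fourier \<phi> \<xi> = 0" "\<And>\<xi>. \<xi> < - r2 \<Longrightarrow> fourier \<phi> \<xi> = 0"
    by (simp_all add: fourier_reflect) (metis minus_less_iff minus_minus)
  show ?thesis
  proof (rule test_functionsI[where r = "max r1 r2"])
    show "smooth (fourier \<phi>)"
      by (intro smooth_fourier Z_space_rapidly_decreasing assms)
    show "fourier \<phi> x = 0" if "max r1 r2 < \<bar>x\<bar>" for x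
      using that r[of x] by (cases "x \<ge> 0") auto
  qed
qed

section \<open>Fourier inversion on the two test spaces\<close>

lemma test_functions_bounded_integrable:
  assumes "g \<in> test_functions"
  shows "\<exists>B. \<forall>x. norm (g x) \<le> B" and "integrable lborel g"
proof -
  obtain r where r: "r > 0" "\<And>x. r < \<bar>x\<bar> \<Longrightarrow> g x = 0"
    using test_functions_supp_bounded[OF assms] by blast
  have cont: "continuous_on S g" for S
    using assms by (intro smooth_continuous_on) (simp add: test_functions_def)
  have "bounded (g ` {-r..r})"
    using cont by (intro compact_imp_bounded compact_continuous_image) auto
  then obtain B where B: "\<And>x. x \<in> {-r..r} \<Longrightarrow> norm (g x) \<le> B"
    unfolding bounded_iff by blast
  have b: "norm (g x) \<le> \<bar>B\<bar>" for x
  proof (cases "r < \<bar>x\<bar>")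
    case False
    then have "x \<in> {-r..r}"
      by auto
    from order_trans[OF B[OF this] abs_ge_self] show ?thesis .
  qed (simp add: r)
  then show "\<exists>B. \<forall>x. norm (g x) \<le> B"
    by blast
  \<comment> \<open>On the support x^2 is at most r^2, so 1 + r^2 compensates the factor 1 / (1 +
    x^2).\<close>
  have "norm (g x) \<le> \<bar>B\<bar> * (1 + r\<^sup>2) * inverse (1 + x\<^sup>2)" for x
  proof (cases "r < \<bar>x\<bar>")
    case False
    then have "x\<^sup>2 \<le> r\<^sup>2"
      using r(1) by (metis abs_le_square_iff abs_of_pos not_less)
    then have "\<bar>B\<bar> * 1 \<le> \<bar>B\<bar> * ((1 + r\<^sup>2) * inverse (1 + x\<^sup>2))"
      by (intro mult_left_mono) (auto simp: field_simps add_pos_nonneg)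
    then show ?thesis
      using b[of x] by (simp add: mult.assoc)
  qed (simp add: r)
  then show "integrable lborel g"
    by (intro integrable_of_inverse_bound cont)
qed

lemma fourier_fourier_adj_test:
  assumes "g \<in> test_functions"
  shows "fourier (fourier_adj g) = g"
proof
  fix x
  obtain B where "\<And>x. norm (g x) \<le> B"
    using test_functions_bounded_integrable(1)[OF assms] by blast
  moreover have "integrable lborel (fourier_adj g)"
    by (intro rapidly_decreasing_integrable Z_space_rapidly_decreasing fourier_adj_test_functions assms)
  moreover have "continuous_on UNIV g"
    using assms by (intro smooth_continuous_on) (simp add: test_functions_def)
  ultimately show "fourier (fourier_adj g) x = g x"
    using test_functions_bounded_integrable(2)[OF assms] by (intro fourier_adj_inversion)
qed

lemma fourier_adj_fourier_Z:
  assumes "\<phi> \<in> Z_space"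
  shows "fourier_adj (fourier \<phi>) = \<phi>"
proof
  fix x
  have "rapidly_decreasing \<phi>"
    by (rule Z_space_rapidly_decreasing[OF assms])
  then obtain B where "\<And>x. norm (\<phi> x) \<le> B * inverse ((1 + \<bar>x\<bar>) ^ 0)" and "continuous_on UNIV \<phi>"
    unfolding rapidly_decreasing_def by blast
  then show "fourier_adj (fourier \<phi>) x = \<phi> x"
    using test_functions_bounded_integrable(2)[OF fourier_Z_space[OF assms]]
      rapidly_decreasing_integrable[OF Z_space_rapidly_decreasing[OF assms]]
    by (intro fourier_inversion[where B = B]) auto
qed

lemma fourier_lincomb:
  assumes "integrable lborel u" "integrable lborel v"
  shows "fourier (\<lambda>x. a * u x + b * v x) = (\<lambda>\<xi>. a * fourier u \<xi> + b * fourier v \<xi>)"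
proof
  fix \<xi>
  have "(LINT x|lborel. (a * u x + b * v x) * exp (- \<i> * of_real x * of_real \<xi>)) =
      (LINT x|lborel. a * (u x * exp (- \<i> * of_real x * of_real \<xi>)) + b * (v x * exp (- \<i> * of_real x * of_real \<xi>)))"
    by (simp add: algebra_simps)
  also have "\<dots> = a * (LINT x|lborel. u x * exp (- \<i> * of_real x * of_real \<xi>)) +
      b * (LINT x|lborel. v x * exp (- \<i> * of_real x * of_real \<xi>))"
    by (subst Bochner_Integration.integral_add)
       (intro integrable_mult_right integrable_mult_exp_i assms | simp only: integral_mult_right_zero)+
  finally show "fourier (\<lambda>x. a * u x + b * v x) \<xi> = a * fourier u \<xi> + b * fourier v \<xi>"
    by (simp add: fourier_def algebra_simps)
qed

section \<open>The Laplace transform in exponential variables\<close>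

text \<open>The change of variables t = exp y, taken from the gauge integral. Absolute integrability
  there refers to the completed measure, and Borel measurability of f brings it back to
  \<open>lborel\<close>.\<close>

lemma exp_substitution:
  fixes f :: "real \<Rightarrow> complex"
  assumes [measurable]: "f \<in> borel_measurable borel"
  shows "set_integrable lborel {0<..} f \<longleftrightarrow> integrable lborel (\<lambda>y. exp y *\<^sub>R f (exp y))" (is "?A \<longleftrightarrow> ?B")
    and "set_integrable lborel {0<..} f \<Longrightarrow>
      (LINT t:{0<..}|lborel. f t) = (LINT y|lborel. exp y *\<^sub>R f (exp y))"
proof -
  have range: "range exp = {0::real<..}"
    using exp_ln by (auto intro!: rangeI simp: image_iff) (metis exp_ln)
  have cov: "(\<lambda>y. \<bar>exp y\<bar> *\<^sub>R f (exp y)) absolutely_integrable_on UNIV \<and>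
      integral UNIV (\<lambda>y. \<bar>exp y\<bar> *\<^sub>R f (exp y)) = b \<longleftrightarrow>
      f absolutely_integrable_on {0<..} \<and> integral {0<..} f = b" for b
    unfolding range[symmetric]
    by (rule has_absolute_integral_change_of_variables_real)
       (auto intro!: derivative_eq_intros simp: inj_on_def)
  have 1: "f absolutely_integrable_on {0<..} \<longleftrightarrow> ?A"
    unfolding set_integrable_def by (rule integrable_completion) auto
  have 2: "(\<lambda>y. \<bar>exp y\<bar> *\<^sub>R f (exp y)) absolutely_integrable_on UNIV \<longleftrightarrow> ?B"
    unfolding set_integrable_def by (subst integrable_completion) auto
  show iff: "?A \<longleftrightarrow> ?B"
    using cov 1 2 by blast
  assume A: ?A
  then have B: "set_integrable lborel UNIV (\<lambda>y. exp y *\<^sub>R f (exp y))"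
    using iff by (simp add: set_integrable_def)
  have "(LINT t:{0<..}|lborel. f t) = integral {0<..} f"
    by (rule set_borel_integral_eq_integral(2)[OF A])
  also have "\<dots> = integral UNIV (\<lambda>y. exp y *\<^sub>R f (exp y))"
    using cov[of "integral {0<..} f"] 1 A by simp
  also have "\<dots> = (LINT y|lborel. exp y *\<^sub>R f (exp y))"
    using set_borel_integral_eq_integral(2)[OF B] by (simp add: set_lebesgue_integral_def)
  finally show "(LINT t:{0<..}|lborel. f t) = (LINT y|lborel. exp y *\<^sub>R f (exp y))" .
qed

text \<open>The density of ln T for T exponentially distributed with mean 1, that is, exp(- t) dt in
  the variable t = exp y.\<close>

definition gumbel :: "real \<Rightarrow> complex" where
  "gumbel y = of_real (exp y * exp (- exp y))"

text \<open>Since y is below exp y, exp y is below exp (exp y). Boundedness makes the convolution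
  with an integrable function exist at every point.\<close>

lemma norm_gumbel_le_1: "norm (gumbel y) \<le> 1"
proof -
  have "exp y \<le> exp (exp y)"
    unfolding exp_le_cancel_iff using exp_ge_add_one_self[of y] by linarith
  then show ?thesis
    unfolding gumbel_def norm_of_real by (simp add: abs_mult exp_minus field_simps)
qed

lemma gumbel_measurable [measurable]: "gumbel \<in> borel_measurable borel"
  unfolding gumbel_def[abs_def] by measurable

lemma gumbel_Gamma:
  shows "integrable lborel gumbel"
    and "(LINT y|lborel. gumbel y * exp (\<i> * of_real y * of_real \<xi>)) = Gamma (1 + \<i> * of_real \<xi>)"
proof -
  \<comment> \<open>The exponent keeps the form z - 1 with z = 1 + i \<xi>, in which Euler's
    integral is stated.\<close>
  define f where "f = (\<lambda>\<xi> t. complex_of_real t powr (1 + \<i> * of_real \<xi> - 1) / of_real (exp t))"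
  have [measurable]: "f \<xi> \<in> borel_measurable borel" for \<xi>
    unfolding f_def by measurable
  have eq: "exp y *\<^sub>R f \<xi> (exp y) = gumbel y * exp (\<i> * of_real y * of_real \<xi>)" for \<xi> y
    by (simp add: f_def gumbel_def powr_def scaleR_conv_of_real exp_minus field_simps Ln_of_real
        flip: exp_of_real)
  have int: "set_integrable lborel {0<..} (f \<xi>)" for \<xi>
  proof -
    have "f \<xi> absolutely_integrable_on {0<..}"
      unfolding f_def by (rule absolutely_integrable_Gamma_integral') simp
    then show ?thesis
      unfolding set_integrable_def by (subst (asm) integrable_completion) auto
  qed
  show "integrable lborel gumbel"
    using int[of 0] unfolding exp_substitution(1)[OF \<open>f 0 \<in> borel_measurable borel\<close>] eq by simp
  have "Gamma (1 + \<i> * of_real \<xi>) = integral {0<..} (f \<xi>)"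
    unfolding f_def by (rule integral_unique[symmetric, OF Gamma_integral_complex']) simp
  also have "\<dots> = (LINT t:{0<..}|lborel. f \<xi> t)"
    by (rule set_borel_integral_eq_integral(2)[symmetric, OF int])
  finally show "(LINT y|lborel. gumbel y * exp (\<i> * of_real y * of_real \<xi>)) = Gamma (1 + \<i> * of_real \<xi>)"
    by (simp add: exp_substitution(2)[OF _ int] eq)
qed

lemma Zplus_D:
  assumes "F \<in> Zplus"
  shows "(\<lambda>x. F (exp x)) \<in> Z_space" "t \<le> 0 \<Longrightarrow> F t = 0"
  using assms by (auto simp: Zplus_def)

text \<open>With \<lambda> = exp (- x) and t = exp y, the measure \<lambda> exp(- t \<lambda>) dt
  becomes gumbel (y - x) dy.\<close>

lemma L1_exp_eq_convolution:
  assumes F: "F \<in> Zplus"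
  shows "L1 F (exp (- x)) = (LINT y|lborel. F (exp y) * gumbel (y - x))"
proof -
  define \<Omega> where "\<Omega> = (\<lambda>x. F (exp x))"
  \<comment> \<open>Measurability of F on the whole line comes from the continuous \<Omega> and the
    value 0 on the negative half-line.\<close>
  have F_eq: "F = (\<lambda>t. if t > 0 then \<Omega> (ln t) else 0)"
    using Zplus_D(2)[OF F] by (auto simp: \<Omega>_def fun_eq_iff)
  have \<Omega>: "integrable lborel \<Omega>"
    unfolding \<Omega>_def by (intro rapidly_decreasing_integrable Z_space_rapidly_decreasing Zplus_D F)
  then have [measurable]: "\<Omega> \<in> borel_measurable borel"
    by auto
  have [measurable]: "F \<in> borel_measurable borel"
    unfolding F_eq by measurable
  define f where "f = (\<lambda>t. complex_of_real (exp (- t * exp (- x))) * F t)"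
  have [measurable]: "f \<in> borel_measurable borel"
    unfolding f_def by measurable
  have eq: "exp y *\<^sub>R f (exp y) = of_real (exp x) * (F (exp y) * gumbel (y - x))" for y
  proof -
    have "complex_of_real (exp x) * of_real (exp (y - x)) = of_real (exp y)"
      by (simp flip: of_real_mult exp_add)
    then show ?thesis
      by (simp add: f_def gumbel_def scaleR_conv_of_real exp_diff exp_minus divide_inverse mult_ac)
  qed
  have "integrable lborel (\<lambda>y. \<Omega> y * gumbel (y - x))"
    by (rule Bochner_Integration.integrable_bound[OF \<Omega>])
       (auto simp: norm_mult norm_gumbel_le_1 intro!: mult_left_le)
  then have "integrable lborel (\<lambda>y. exp y *\<^sub>R f (exp y))"
    unfolding eq \<Omega>_def by (rule integrable_mult_right)
  then have "(LINT t:{0<..}|lborel. f t) = (LINT y|lborel. exp y *\<^sub>R f (exp y))"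
    by (intro exp_substitution(2)) (simp_all add: exp_substitution(1))
  also have "\<dots> = of_real (exp x) * (LINT y|lborel. F (exp y) * gumbel (y - x))"
    unfolding eq by simp
  finally show ?thesis
    by (simp add: L1_def f_def exp_minus)
qed

text \<open>Fubini applies because the norm of a translated kernel does not depend on y. The kernel
  has argument y - x, so the substitution v = y - x flips the sign of the exponent and gives Gamma
  at 1 + i \<xi> and not at 1 - i \<xi>.\<close>

lemma fourier_L1:
  assumes F: "F \<in> Zplus"
  shows "fourier (\<lambda>x. L1 F (exp (- x))) \<xi> = Gamma (1 + \<i> * of_real \<xi>) * fourier (\<lambda>x. F (exp x)) \<xi>"
proof -
  define \<Omega> where "\<Omega> = (\<lambda>x. F (exp x))"
  have \<Omega>: "integrable lborel \<Omega>"
    unfolding \<Omega>_def by (intro rapidly_decreasing_integrable Z_space_rapidly_decreasing Zplus_D F)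
  then have [measurable]: "\<Omega> \<in> borel_measurable borel"
    by auto
  define E where "E = (\<lambda>x. exp (- \<i> * of_real x * of_real \<xi>))"
  have [measurable]: "E \<in> borel_measurable borel"
    unfolding E_def by measurable
  have normE: "norm (E x) = 1" for x
    by (simp add: E_def)
  have shift: "integrable lborel (\<lambda>x. gumbel (y - x))" for y
    using lborel_integrable_real_affine[OF gumbel_Gamma(1), of "-1" y] by simp
  have norm_shift: "(LINT x|lborel. norm (gumbel (y - x))) = (LINT x|lborel. norm (gumbel x))" for y
    using lborel_integral_real_affine[of "-1" "\<lambda>x. norm (gumbel x)" y] by simp
  have "integrable (lborel \<Otimes>\<^sub>M lborel) (\<lambda>(y, x). \<Omega> y * gumbel (y - x) * E x)"
  proof (rule pair_sigma_finite.Fubini_integrable[OF pair_sigma_finite_lborel])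
    have "integrable lborel (\<lambda>y. norm (\<Omega> y) * (LINT x|lborel. norm (gumbel x)))"
      by (intro integrable_mult_left integrable_norm \<Omega>)
    then show "integrable lborel (\<lambda>y. LINT x|lborel. norm (case (y, x) of (y, x) \<Rightarrow> \<Omega> y * gumbel (y - x) * E x))"
      by (simp add: norm_mult normE norm_shift)
    have "integrable lborel (\<lambda>x. \<Omega> y * gumbel (y - x) * E x)" for y
      by (rule Bochner_Integration.integrable_bound[OF integrable_mult_right[OF shift]])
         (auto simp: norm_mult normE)
    then show "AE y in lborel. integrable lborel (\<lambda>x. case (y, x) of (y, x) \<Rightarrow> \<Omega> y * gumbel (y - x) * E x)"
      by simp
  qed measurable
  from pair_sigma_finite.Fubini_integral[OF pair_sigma_finite_lborel this]
  have "(LINT x|lborel. LINT y|lborel. \<Omega> y * gumbel (y - x) * E x) =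
      (LINT y|lborel. LINT x|lborel. \<Omega> y * gumbel (y - x) * E x)" .
  also have "\<dots> = (LINT y|lborel. Gamma (1 + \<i> * of_real \<xi>) * (\<Omega> y * E y))"
  proof (intro Bochner_Integration.integral_cong refl)
    fix y
    have "(LINT x|lborel. \<Omega> y * gumbel (y - x) * E x) =
        (LINT v|lborel. \<Omega> y * E y * (gumbel v * exp (\<i> * of_real v * of_real \<xi>)))"
    proof (subst lborel_integral_real_affine[where c = "-1" and t = y])
      have "E (y - v) = E y * exp (\<i> * of_real v * of_real \<xi>)" for v
        by (simp add: E_def algebra_simps flip: exp_add)
      then show "\<bar>-1\<bar> *\<^sub>R (LINT x|lborel. \<Omega> y * gumbel (y - (y + - 1 * x)) * E (y + - 1 * x)) =
          (LINT v|lborel. \<Omega> y * E y * (gumbel v * exp (\<i> * of_real v * of_real \<xi>)))"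
        by (simp add: mult_ac)
    qed simp
    then show "(LINT x|lborel. \<Omega> y * gumbel (y - x) * E x) = Gamma (1 + \<i> * of_real \<xi>) * (\<Omega> y * E y)"
      by (simp add: gumbel_Gamma(2))
  qed
  finally show ?thesis
    by (simp add: fourier_def L1_exp_eq_convolution[OF F] E_def \<Omega>_def)
qed

section \<open>Recovery of a distribution from its sign-function\<close>

text \<open>The function at which h is evaluated once the definitions of \<theta>, a, b, s and the
  reflected distribution are unfolded; the value 0 for t \<le> 0 is the encoding of functions on the
  half-line.\<close>

definition natural_adjoint :: "(real \<Rightarrow> complex) \<Rightarrow> real \<Rightarrow> complex" where
  "natural_adjoint F = (\<lambda>t. if t > 0
     then fourier_adj (\<lambda>\<xi>. inverse (Gamma (1 + \<i> * of_real \<xi>)) * fourier (\<lambda>x. F (exp (- x))) \<xi>) (ln t)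
     else 0)"

lemma natural_dist_sign_function: "natural_dist (sign_function h) F = h (natural_adjoint F)"
proof -
  have "of_real (sqrt (2 * pi)) * (of_real ((2 * pi) powr (-1/2)) * w) = w" for w :: complex
    using sqrt_2pi_powr by (metis mult.assoc mult.commute mult_1)
  then show ?thesis
    by (simp only: natural_dist_def sign_function_def b_dist_def a_dist_def theta_dist_def
        natural_adjoint_def)
qed

text \<open>The reciprocal Gamma function is entire.\<close>

lemma smooth_inverse_Gamma: "smooth (\<lambda>\<xi>. inverse (Gamma (1 + \<i> * of_real \<xi>)))"
proof -
  have "smooth (\<lambda>\<xi>. (\<lambda>z. rGamma (1 + \<i> * z)) (of_real \<xi>))"
    by (intro smooth_of_real holomorphic_intros)
  then show ?thesis
    by (simp add: rGamma_inverse_Gamma)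
qed

lemma natural_adjoint_integrand:
  assumes "F \<in> Zplus"
  shows "(\<lambda>\<xi>. inverse (Gamma (1 + \<i> * of_real \<xi>)) * fourier (\<lambda>x. F (exp (- x))) \<xi>) \<in> test_functions"
  using Z_space_reflect[OF Zplus_D(1)[OF assms]]
  by (intro test_functions_mult smooth_inverse_Gamma fourier_Z_space)

lemma natural_adjoint_exp:
  "(\<lambda>x. natural_adjoint F (exp x)) =
    fourier_adj (\<lambda>\<xi>. inverse (Gamma (1 + \<i> * of_real \<xi>)) * fourier (\<lambda>x. F (exp (- x))) \<xi>)"
  by (simp add: natural_adjoint_def)

lemma natural_adjoint_Zplus:
  assumes "F \<in> Zplus"
  shows "natural_adjoint F \<in> Zplus"
  using fourier_adj_test_functions[OF natural_adjoint_integrand[OF assms]]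
  by (simp add: Zplus_def natural_adjoint_exp) (simp add: natural_adjoint_def)

lemma natural_adjoint_L1:
  assumes F: "F \<in> Zplus"
  shows "natural_adjoint (L1 F) = F"
proof
  fix t
  \<comment> \<open>Gamma takes the default value 0 exactly at its poles, the nonpositive integers;
    1 + i \<xi> has real part 1.\<close>
  have "Gamma (1 + \<i> * of_real \<xi>) \<noteq> 0" for \<xi>
    unfolding Gamma_eq_zero_iff by (auto simp: complex_eq_iff elim!: nonpos_Ints_cases)
  then have "natural_adjoint (L1 F) t = (if t > 0 then fourier_adj (fourier (\<lambda>x. F (exp x))) (ln t) else 0)"
    by (simp add: natural_adjoint_def fourier_L1[OF F] flip: mult.assoc)
  then show "natural_adjoint (L1 F) t = F t"
    using Zplus_D(2)[OF F, of t] by (simp add: fourier_adj_fourier_Z[OF Zplus_D(1)[OF F]])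
qed

lemma natural_adjoint_lincomb:
  assumes "F \<in> Zplus" "G \<in> Zplus"
  shows "natural_adjoint (\<lambda>x. a * F x + b * G x) = (\<lambda>x. a * natural_adjoint F x + b * natural_adjoint G x)"
proof -
  define m where "m = (\<lambda>\<xi>. inverse (Gamma (1 + \<i> * complex_of_real \<xi>)))"
  have int: "integrable lborel (\<lambda>x. F (exp (- x)))" if "F \<in> Zplus" for F
    using Z_space_reflect[OF Zplus_D(1)[OF that]]
    by (intro rapidly_decreasing_integrable Z_space_rapidly_decreasing)
  have "fourier_adj (\<lambda>\<xi>. a * (m \<xi> * fourier (\<lambda>x. F (exp (- x))) \<xi>) + b * (m \<xi> * fourier (\<lambda>x. G (exp (- x))) \<xi>)) y =
     a * fourier_adj (\<lambda>\<xi>. m \<xi> * fourier (\<lambda>x. F (exp (- x))) \<xi>) y +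
     b * fourier_adj (\<lambda>\<xi>. m \<xi> * fourier (\<lambda>x. G (exp (- x))) \<xi>) y" for y
    using test_functions_bounded_integrable(2)[OF natural_adjoint_integrand] assms
    by (simp add: fourier_adj_eq_fourier fourier_lincomb m_def)
  then show ?thesis
    by (auto simp: natural_adjoint_def fun_eq_iff fourier_lincomb[OF int int, OF assms] m_def algebra_simps)
qed

section \<open>Continuity on the pulled-back topologies\<close>

text \<open>The carrier of a pullback is cut down to the functions mapped into the test functions;
  \<open>fourier_Z_space\<close> shows that nothing is lost.\<close>

lemma topspace_Z_topology: "topspace Z_topology = Z_space"
  unfolding Z_topology_def topspace_pullback_topology topspace_test_topology
  using fourier_Z_space by auto

lemma topspace_Zplus_topology: "topspace Zplus_topology = Zplus"
  unfolding Zplus_topology_def topspace_pullback_topology topspace_Z_topology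
  using Zplus_D by auto

text \<open>Continuity into a pullback is tested after applying \<open>fourier\<close> in the
  variable ln t. There inversion on test functions removes \<open>fourier_adj\<close>, and what is
  left is reflection and multiplication applied to the transform of F (exp x).\<close>

lemma continuous_map_natural_adjoint:
  "continuous_map Zplus_topology Zplus_topology natural_adjoint"
proof -
  define A where "A = (\<lambda>u \<xi>. inverse (Gamma (1 + \<i> * of_real \<xi>)) * u (- \<xi>) :: complex)"
  define E where "E = (\<lambda>(F :: real \<Rightarrow> complex) x. F (exp x))"
  have "continuous_map test_topology test_topology A"
    unfolding A_def by (rule continuous_map_test_mult_reflect[OF smooth_inverse_Gamma])
  then have "continuous_map Zplus_topology test_topology ((A \<circ> fourier) \<circ> E)"
    unfolding Zplus_topology_def Z_topology_def E_def by (intro continuous_map_pullback)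
  moreover have "((A \<circ> fourier) \<circ> E) F = (fourier \<circ> (E \<circ> natural_adjoint)) F"
    if "F \<in> topspace Zplus_topology" for F
  proof -
    have F: "F \<in> Zplus"
      using that by (simp add: topspace_Zplus_topology)
    show ?thesis
      using fourier_fourier_adj_test[OF natural_adjoint_integrand[OF F]] fourier_reflect[of "\<lambda>x. F (exp x)"]
      by (simp add: E_def natural_adjoint_exp A_def)
  qed
  ultimately have "continuous_map Zplus_topology test_topology (fourier \<circ> (E \<circ> natural_adjoint))"
    by (rule continuous_map_eq)
  then have "continuous_map Zplus_topology Z_topology (E \<circ> natural_adjoint)"
    unfolding Z_topology_def
    by (rule continuous_map_pullback')
       (use natural_adjoint_Zplus Zplus_D(1) in \<open>auto simp: topspace_Zplus_topology E_def\<close>)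
  then show ?thesis
    unfolding E_def
    by (subst (2) Zplus_topology_def, intro continuous_map_pullback')
       (use natural_adjoint_Zplus in \<open>auto simp: topspace_Zplus_topology\<close>)
qed

theorem theorem2p9:
  fixes h s hn :: "(real \<Rightarrow> complex) \<Rightarrow> complex"
  assumes "h \<in> Zplus_dual"
    and "s = sign_function h"
    and "hn = natural_dist s"
  shows "hn \<in> Zplus_dual \<and> (\<forall>F\<in>Zplus. h F = hn (L1 F))"
proof (intro conjI ballI)
  have hn: "hn = h \<circ> natural_adjoint"
    using assms(2,3) by (auto simp: natural_dist_sign_function)
  have h: "antilinear_on Zplus h" "continuous_map Zplus_topology euclidean h"
    using assms(1) by (auto simp: Zplus_dual_def)
  have "antilinear_on Zplus hn"
    using h(1) unfolding antilinear_on_def hn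
    by (simp add: natural_adjoint_lincomb natural_adjoint_Zplus)
  moreover have "continuous_map Zplus_topology euclidean hn"
    unfolding hn by (rule continuous_map_compose[OF continuous_map_natural_adjoint h(2)])
  ultimately show "hn \<in> Zplus_dual"
    by (simp add: Zplus_dual_def)
  fix F
  assume "F \<in> Zplus"
  then show "h F = hn (L1 F)"
    by (simp add: hn natural_adjoint_L1)
qed

end
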